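(* Let $K$ be a field, $\Lambda$ a $1$-graph and $C$ a connected component of $\mathbf{RG}(\Lambda)$. Then the $\mathrm{KP}(\Lambda)$-module $V_{(\Omega_C,\zeta_C)}$ is indecomposable.
   Context: **$k$-graphs.** $\mathbb N=\{0,1,2,\dots\}$; for a positive integer $k$ the additive monoid $\mathbb N^k$ is viewed as a category with one object. A $k$-graph is a small category $\Lambda$ (the symbol $\Lambda$ also denotes its set of morphisms, $\Lambda^{\mathrm{ob}}$ its set of objects or vertices, $r,s$ the range and source maps) together with a functor $d:\Lambda\to\mathbb N^k$ (degree map) such that: if $d(\lambda)=m+n$ with $m,n\in\mathbb N^k$, there are unique $\mu,\nu\in\Lambda$ with $d(\mu)=m$, $d(\nu)=n$, $\lambda=\mu\circ\nu$. For $u,v\in\Lambda^{\mathrm{ob}}$, $n\in\mathbb N^k$: $u\Lambda=r^{-1}(u)$, $\Lambda v=s^{-1}(v)$, $u\Lambda v=u\Lambda\cap\Lambda v$, $u\Lambda^n=u\Lambda\cap d^{-1}(n)$. A morphism of $k$-graphs is a degree-preserving functor. Standing assumption: all $k$-graphs are nonempty ($\Lambda^{\mathrm{ob}}\ne\emptyset$), connected (the equivalence relation on $\Lambda^{\mathrm{ob}}$ generated by $\{(u,v): u\Lambda v\neq\emptyset\}$ is all of $\Lambda^{\mathrm{ob}}\times\Lambda^{\mathrm{ob}}$), row-finite (each $v\Lambda^n$ is finite) and without sources (each $v\Lambda^n$ is nonempty). **Representation $k$-graphs.** A representation $k$-graph for $\Lambda$ is a pair $(\Delta,\alpha)$ of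 a $k$-graph $\Delta$ and a $k$-graph morphism $\alpha:\Delta\to\Lambda$ such that for every $v\in\Delta^{\mathrm{ob}}$: (i) $\alpha$ maps $\Delta v$ bijectively onto $\Lambda\alpha(v)$; (ii) $v\Delta^n$ is a singleton for every $n\in\mathbb N^k$. A morphism $(\Delta,\alpha)\to(\Sigma,\beta)$ is a $k$-graph morphism $\phi:\Delta\to\Sigma$ with $\beta\circ\phi=\alpha$. This gives the category $\mathbf{RG}(\Lambda)$. The connected components of a category are the full subcategories on the classes of objects for the equivalence relation generated by existence of a morphism. **Coverings.** A covering of a $k$-graph $\Delta$ is a pair $(\Omega,\tau)$ of a $k$-graph $\Omega$ and a $k$-graph morphism $\tau:\Omega\to\Delta$ such that for every $v\in\Omega^{\mathrm{ob}}$, $\tau$ maps $\Omega v$ bijectively onto $\Delta\tau(v)$ and $v\Omega$ bijectively onto $\tau(v)\Delta$. A morphism of coverings $(\Omega,\tau)\to(\Sigma,\beta)$ is a $k$-graph morphism $\phi:\Omega\to\Sigma$ with $\beta\circ\phi=\tau$. A covering is universal if it admits a morphism to every covering; every $k$-graph has a universal covering. **The object $(\Omega_C,\zeta_C)$.** Choose an object $(\Delta,\alpha)$ of $C$ and a universal covering $(\Omega,\tau)$ of $\Delta$; set $(\Omega_C,\zeta_C):=(\Omega,\alpha\circ\tau)$, which is an object of $C$. **Kumjian-Pask algebra.** $K$-algebras are associative, not necessarily commutative or unital. For $\lambda\in\Lambda$ of nonzero degree let $\lambda^*$ be a new symbol; for $\lambda$ of degree $0$ put $\lambda^*:=\lambda$.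 $\mathrm{KP}(\Lambda)$ is the $K$-algebra presented by generators $\Lambda\cup\Lambda^*$ and relations: (KP1) $\lambda\mu=\delta_{s(\lambda),r(\mu)}(\lambda\circ\mu)$ for $\lambda,\mu\in\Lambda$; (KP2) $\mu^*\lambda^*=\delta_{s(\lambda),r(\mu)}(\lambda\circ\mu)^*$ for $\lambda,\mu\in\Lambda$; (KP3) $\lambda^*\mu=\delta_{\lambda,\mu}1_{s(\lambda)}$ for $\lambda,\mu\in\Lambda$ with $d(\lambda)=d(\mu)$; (KP4) $\sum_{\lambda\in v\Lambda^n}\lambda\lambda^*=1_v$ for $v\in\Lambda^{\mathrm{ob}}$, $n\in\mathbb N^k$. **The module $V_{(\Delta,\alpha)}$.** It is the $K$-vector space with basis $\Delta^{\mathrm{ob}}$, with the left $\mathrm{KP}(\Lambda)$-action determined, for $\lambda\in\Lambda$ and $v\in\Delta^{\mathrm{ob}}$, by: $\lambda.v=r(\delta)$ if there is a (necessarily unique) $\delta\in\Delta v$ with $\alpha(\delta)=\lambda$, and $\lambda.v=0$ otherwise; $\lambda^*.v=s(\delta)$ if there is a (necessarily unique) $\delta\in v\Delta$ with $\alpha(\delta)=\lambda$, and $\lambda^*.v=0$ otherwise. A module is indecomposable if it is nonzero and is not a direct sum of two nonzero submodules. *)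

theory Defs
  imports
    "HOL-Analysis.Finite_Cartesian_Product"
    "HOL-Library.FuncSet"
    "HOL-Library.Infinite_Typeclass"
    "HOL-Library.Numeral_Type"
    "HOL-Library.Poly_Mapping"
begin

section \<open>Small categories and their connected components\<close>

record ('o, 'm) category =
  Ob  :: "'o set"
  Mor :: "'m set"
  src :: "'m \<Rightarrow> 'o"
  rng :: "'m \<Rightarrow> 'o"
  idt :: "'o \<Rightarrow> 'm"
  cmp :: "'m \<Rightarrow> 'm \<Rightarrow> 'm"

text \<open>The composite \<open>cmp C f g\<close> is \<open>f \<circ> g\<close>; it is meaningful if \<open>src C f = rng C g\<close>.\<close>

locale small_category =
  fixes C :: "('o, 'm, 'x) category_scheme"
  assumes src_in: "f \<in> Mor C \<Longrightarrow> src C f \<in> Ob C"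
    and rng_in: "f \<in> Mor C \<Longrightarrow> rng C f \<in> Ob C"
    and idt_in: "v \<in> Ob C \<Longrightarrow> idt C v \<in> Mor C"
    and src_idt: "v \<in> Ob C \<Longrightarrow> src C (idt C v) = v"
    and rng_idt: "v \<in> Ob C \<Longrightarrow> rng C (idt C v) = v"
    and cmp_in: "\<lbrakk>f \<in> Mor C; g \<in> Mor C; src C f = rng C g\<rbrakk> \<Longrightarrow> cmp C f g \<in> Mor C"
    and src_cmp: "\<lbrakk>f \<in> Mor C; g \<in> Mor C; src C f = rng C g\<rbrakk> \<Longrightarrow> src C (cmp C f g) = src C g"
    and rng_cmp: "\<lbrakk>f \<in> Mor C; g \<in> Mor C; src C f = rng C g\<rbrakk> \<Longrightarrow> rng C (cmp C f g) = rng C f"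
    and cmp_idt: "f \<in> Mor C \<Longrightarrow> cmp C f (idt C (src C f)) = f"
    and idt_cmp: "f \<in> Mor C \<Longrightarrow> cmp C (idt C (rng C f)) f = f"
    and cmp_assoc: "\<lbrakk>f \<in> Mor C; g \<in> Mor C; h \<in> Mor C; src C f = rng C g; src C g = rng C h\<rbrakk>
      \<Longrightarrow> cmp C (cmp C f g) h = cmp C f (cmp C g h)"

definition generated_equiv :: "'a set \<Rightarrow> ('a \<times> 'a) set \<Rightarrow> ('a \<times> 'a) set" where
  "generated_equiv A R = \<Inter>{E. equiv A E \<and> R \<subseteq> E}"

definition connected_rel :: "('o, 'm, 'x) category_scheme \<Rightarrow> ('o \<times> 'o) set" where
  "connected_rel C = generated_equiv (Ob C) {(rng C f, src C f) | f. f \<in> Mor C}"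

definition full_subcategory ::
  "('o, 'm, 'x) category_scheme \<Rightarrow> 'o set \<Rightarrow> ('o, 'm, 'x) category_scheme" where
  "full_subcategory C S = C\<lparr>Ob := S, Mor := {f \<in> Mor C. src C f \<in> S \<and> rng C f \<in> S}\<rparr>"

definition connected_components ::
  "('o, 'm, 'x) category_scheme \<Rightarrow> ('o, 'm, 'x) category_scheme set" where
  "connected_components C = full_subcategory C ` (Ob C // connected_rel C)"


section \<open>$k$-graphs\<close>

text \<open>The finite index type \<open>'k\<close> plays the role of $k$: a $k$-graph has \<open>CARD('k) = k\<close>,
  and a $1$-graph is a \<open>('o, 'm, 1) kgraph\<close>.\<close>

record ('o, 'm, 'k) kgraph = "('o, 'm) category" +
  deg :: "'m \<Rightarrow> nat ^ 'k"

text \<open>Paths with a given range, a given source, and a given range and degree: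
  $u\Lambda$, $\Lambda v$ and $u\Lambda^n$.\<close>

definition with_rng :: "('o, 'm, 'k::finite) kgraph \<Rightarrow> 'o \<Rightarrow> 'm set" where
  "with_rng G u = {f \<in> Mor G. rng G f = u}"

definition with_src :: "('o, 'm, 'k::finite) kgraph \<Rightarrow> 'o \<Rightarrow> 'm set" where
  "with_src G v = {f \<in> Mor G. src G f = v}"

definition with_rng_deg :: "('o, 'm, 'k::finite) kgraph \<Rightarrow> 'o \<Rightarrow> nat ^ 'k \<Rightarrow> 'm set" where
  "with_rng_deg G u n = {f \<in> with_rng G u. deg G f = n}"

text \<open>The last four axioms are the standing assumptions: nonempty, connected, row-finite and
  without sources.\<close>

locale k_graph = small_category G for G :: "('o, 'm, 'k::finite) kgraph" +
  assumes deg_idt: "v \<in> Ob G \<Longrightarrow> deg G (idt G v) = 0"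
    and deg_cmp: "\<lbrakk>f \<in> Mor G; g \<in> Mor G; src G f = rng G g\<rbrakk>
      \<Longrightarrow> deg G (cmp G f g) = deg G f + deg G g"
    and factorization: "\<lbrakk>f \<in> Mor G; deg G f = m + n\<rbrakk> \<Longrightarrow>
      \<exists>!(g, h). g \<in> Mor G \<and> h \<in> Mor G \<and> src G g = rng G h \<and>
        deg G g = m \<and> deg G h = n \<and> f = cmp G g h"
    and nonempty: "Ob G \<noteq> {}"
    and connected: "connected_rel G = Ob G \<times> Ob G"
    and row_finite: "v \<in> Ob G \<Longrightarrow> finite (with_rng_deg G v n)"
    and no_sources: "v \<in> Ob G \<Longrightarrow> with_rng_deg G v n \<noteq> {}"

text \<open>A morphism is a pair of an object map and a path map. Both are required to be
  extensional (\<open>undefined\<close> off the domain), so that equality of morphisms is equality of pairs.\<close>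

type_synonym ('o, 'm, 'p, 'n) kmor = "('o \<Rightarrow> 'p) \<times> ('m \<Rightarrow> 'n)"

definition kgraph_mor ::
  "('o, 'm, 'k::finite) kgraph \<Rightarrow> ('p, 'n, 'k) kgraph \<Rightarrow> ('o, 'm, 'p, 'n) kmor \<Rightarrow> bool" where
  "kgraph_mor G H \<phi> \<longleftrightarrow>
     fst \<phi> \<in> Ob G \<rightarrow>\<^sub>E Ob H \<and> snd \<phi> \<in> Mor G \<rightarrow>\<^sub>E Mor H \<and>
     (\<forall>f\<in>Mor G. src H (snd \<phi> f) = fst \<phi> (src G f) \<and> rng H (snd \<phi> f) = fst \<phi> (rng G f) \<and>
        deg H (snd \<phi> f) = deg G f) \<and>
     (\<forall>v\<in>Ob G. snd \<phi> (idt G v) = idt H (fst \<phi> v)) \<and>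
     (\<forall>f\<in>Mor G. \<forall>g\<in>Mor G. src G f = rng G g \<longrightarrow>
        snd \<phi> (cmp G f g) = cmp H (snd \<phi> f) (snd \<phi> g))"

definition kmor_id :: "('o, 'm, 'k::finite) kgraph \<Rightarrow> ('o, 'm, 'o, 'm) kmor" where
  "kmor_id G = (restrict id (Ob G), restrict id (Mor G))"

text \<open>\<open>kmor_comp G \<psi> \<phi>\<close> is the composite \<open>\<psi> \<circ> \<phi>\<close>, where \<open>\<phi>\<close> has domain \<open>G\<close>.\<close>

definition kmor_comp :: "('o, 'm, 'k::finite) kgraph \<Rightarrow> ('p, 'n, 'q, 'l) kmor \<Rightarrow>
    ('o, 'm, 'p, 'n) kmor \<Rightarrow> ('o, 'm, 'q, 'l) kmor" where
  "kmor_comp G \<psi> \<phi> = (compose (Ob G) (fst \<psi>) (fst \<phi>), compose (Mor G) (snd \<psi>) (snd \<phi>))"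


section \<open>Representation $k$-graphs\<close>

type_synonym ('o, 'm, 'p, 'n, 'k) over = "('o, 'm, 'k) kgraph \<times> ('o, 'm, 'p, 'n) kmor"

definition rep_kgraph ::
  "('p, 'n, 'k::finite) kgraph \<Rightarrow> ('o, 'm, 'p, 'n, 'k) over \<Rightarrow> bool" where
  "rep_kgraph \<Lambda> = (\<lambda>(\<Delta>, \<alpha>). k_graph \<Delta> \<and> kgraph_mor \<Delta> \<Lambda> \<alpha> \<and>
     (\<forall>v\<in>Ob \<Delta>. bij_betw (snd \<alpha>) (with_src \<Delta> v) (with_src \<Lambda> (fst \<alpha> v))) \<and>
     (\<forall>v\<in>Ob \<Delta>. \<forall>n. \<exists>\<delta>. with_rng_deg \<Delta> v n = {\<delta>}))"

text \<open>The category $\mathbf{RG}(\Lambda)$, restricted to those representation $k$-graphs whose vertices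
  and paths are drawn from the types \<open>'o\<close> and \<open>'m\<close>. A morphism is recorded together with its
  domain and codomain.\<close>

definition RG :: "('p, 'n, 'k::finite) kgraph \<Rightarrow>
    (('o, 'm, 'p, 'n, 'k) over,
     ('o, 'm, 'p, 'n, 'k) over \<times> ('o, 'm, 'o, 'm) kmor \<times> ('o, 'm, 'p, 'n, 'k) over) category" where
  "RG \<Lambda> = \<lparr>
     Ob = {X. rep_kgraph \<Lambda> X},
     Mor = {(X, \<phi>, Y). rep_kgraph \<Lambda> X \<and> rep_kgraph \<Lambda> Y \<and> kgraph_mor (fst X) (fst Y) \<phi> \<and>
        kmor_comp (fst X) (snd Y) \<phi> = snd X},
     src = (\<lambda>(X, \<phi>, Y). X),
     rng = (\<lambda>(X, \<phi>, Y). Y),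
     idt = (\<lambda>X. (X, kmor_id (fst X), X)),
     cmp = (\<lambda>(Y, \<psi>, Z) (X, \<phi>, Y'). (X, kmor_comp (fst X) \<psi> \<phi>, Z))\<rparr>"


section \<open>Coverings\<close>

definition covering :: "('p, 'n, 'k::finite) kgraph \<Rightarrow> ('o, 'm, 'p, 'n, 'k) over \<Rightarrow> bool" where
  "covering \<Delta> = (\<lambda>(\<Omega>, \<tau>). k_graph \<Omega> \<and> kgraph_mor \<Omega> \<Delta> \<tau> \<and>
     (\<forall>v\<in>Ob \<Omega>. bij_betw (snd \<tau>) (with_src \<Omega> v) (with_src \<Delta> (fst \<tau> v)) \<and>
                bij_betw (snd \<tau>) (with_rng \<Omega> v) (with_rng \<Delta> (fst \<tau> v))))"

definition covering_mor ::
  "('o, 'm, 'p, 'n, 'k::finite) over \<Rightarrow> ('q, 'l, 'p, 'n, 'k) over \<Rightarrow> ('o, 'm, 'q, 'l) kmor \<Rightarrow> bool" where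
  "covering_mor = (\<lambda>(\<Omega>, \<tau>) (\<Sigma>, \<beta>) \<phi>. kgraph_mor \<Omega> \<Sigma> \<phi> \<and> kmor_comp \<Omega> \<beta> \<phi> = \<tau>)"

text \<open>HOL cannot quantify over the types of the competing coverings \<open>Y\<close>, so these range over
  the types \<open>'o\<close> and \<open>'m\<close> from which \<open>\<Delta>\<close> itself is drawn. Nothing is lost as long as \<open>'o\<close> and
  \<open>'m\<close> are infinite: a covering of \<open>\<Delta>\<close> is connected, hence has at most
  $\max(\aleph_0, |\mathrm{Mor}\,\Delta|)$ vertices and paths, and row-finiteness gives
  $|\mathrm{Mor}\,\Delta| \le \max(\aleph_0, |\mathrm{Ob}\,\Delta|)$; so every covering of \<open>\<Delta>\<close> has an
  isomorphic copy in these types.\<close>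

definition universal_covering ::
  "('o::infinite, 'm::infinite, 'k::finite) kgraph \<Rightarrow> ('o, 'm, 'o, 'm, 'k) over \<Rightarrow> bool" where
  "universal_covering \<Delta> X \<longleftrightarrow> covering \<Delta> X \<and>
     (\<forall>Y :: ('o, 'm, 'o, 'm, 'k) over. covering \<Delta> Y \<longrightarrow> (\<exists>\<phi>. covering_mor X Y \<phi>))"


section \<open>Algebras given by generators and relations\<close>

text \<open>Words over \<open>'x\<close> form the free monoid, written additively so that \<open>'x word \<Rightarrow>\<^sub>0 'K\<close> is its
  monoid algebra.\<close>

datatype 'x word = Word (letters: "'x list")

instantiation word :: (type) monoid_add
begin
definition zero_word :: "'x word" where "zero_word = Word []"
definition plus_word :: "'x word \<Rightarrow> 'x word \<Rightarrow> 'x word" where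
  "plus_word u w = Word (letters u @ letters w)"
instance by standard (simp_all add: zero_word_def plus_word_def)
end

definition pm_scale :: "'K::field \<Rightarrow> ('b \<Rightarrow>\<^sub>0 'K) \<Rightarrow> ('b \<Rightarrow>\<^sub>0 'K)" where
  "pm_scale c = Poly_Mapping.map ((*) c)"

text \<open>The free non-unital algebra on \<open>X\<close> consists of the combinations of nonempty words.\<close>

definition free_alg :: "'x set \<Rightarrow> ('x word \<Rightarrow>\<^sub>0 'K::field) set" where
  "free_alg X = {p. \<forall>w\<in>Poly_Mapping.keys p. letters w \<noteq> [] \<and> set (letters w) \<subseteq> X}"

definition gen :: "'x \<Rightarrow> ('x word \<Rightarrow>\<^sub>0 'K::field)" where
  "gen x = Poly_Mapping.single (Word [x]) 1"

inductive_set ideal_gen ::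
  "('x word \<Rightarrow>\<^sub>0 'K::field) set \<Rightarrow> ('x word \<Rightarrow>\<^sub>0 'K) set \<Rightarrow> ('x word \<Rightarrow>\<^sub>0 'K) set"
  for F R where
  ideal_incl: "p \<in> R \<Longrightarrow> p \<in> ideal_gen F R"
| ideal_zero: "0 \<in> ideal_gen F R"
| ideal_add: "\<lbrakk>p \<in> ideal_gen F R; q \<in> ideal_gen F R\<rbrakk> \<Longrightarrow> p + q \<in> ideal_gen F R"
| ideal_scale: "p \<in> ideal_gen F R \<Longrightarrow> pm_scale c p \<in> ideal_gen F R"
| ideal_left: "\<lbrakk>a \<in> F; p \<in> ideal_gen F R\<rbrakk> \<Longrightarrow> a * p \<in> ideal_gen F R"
| ideal_right: "\<lbrakk>a \<in> F; p \<in> ideal_gen F R\<rbrakk> \<Longrightarrow> p * a \<in> ideal_gen F R"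

record ('K, 'a) nu_algebra =
  acarrier :: "'a set"
  azero :: 'a
  aadd :: "'a \<Rightarrow> 'a \<Rightarrow> 'a"
  ascale :: "'K \<Rightarrow> 'a \<Rightarrow> 'a"
  amult :: "'a \<Rightarrow> 'a \<Rightarrow> 'a"

definition ideal_cong ::
  "'x set \<Rightarrow> ('x word \<Rightarrow>\<^sub>0 'K::field) set \<Rightarrow> (('x word \<Rightarrow>\<^sub>0 'K) \<times> ('x word \<Rightarrow>\<^sub>0 'K)) set" where
  "ideal_cong X R =
     {(p, q). p \<in> free_alg X \<and> q \<in> free_alg X \<and> p - q \<in> ideal_gen (free_alg X) R}"

definition presented_algebra ::
  "'x set \<Rightarrow> ('x word \<Rightarrow>\<^sub>0 'K::field) set \<Rightarrow> ('K, ('x word \<Rightarrow>\<^sub>0 'K) set) nu_algebra" where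
  "presented_algebra X R = \<lparr>
     acarrier = free_alg X // ideal_cong X R,
     azero = ideal_cong X R `` {0},
     aadd = (\<lambda>A B. \<Union>p\<in>A. \<Union>q\<in>B. ideal_cong X R `` {p + q}),
     ascale = (\<lambda>c A. \<Union>p\<in>A. ideal_cong X R `` {pm_scale c p}),
     amult = (\<lambda>A B. \<Union>p\<in>A. \<Union>q\<in>B. ideal_cong X R `` {p * q})\<rparr>"


section \<open>Kumjian-Pask algebras\<close>

datatype 'm kp_gen = Path 'm | Ghost 'm

type_synonym ('K, 'm) kp_free = "'m kp_gen word \<Rightarrow>\<^sub>0 'K"

text \<open>The symbol \<open>\<lambda>\<^sup>*\<close> is a new one only for \<open>\<lambda>\<close> of nonzero degree.\<close>

definition star :: "('o, 'm, 'k::finite) kgraph \<Rightarrow> 'm \<Rightarrow> 'm kp_gen" where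
  "star \<Lambda> l = (if deg \<Lambda> l = 0 then Path l else Ghost l)"

definition kp_gens :: "('o, 'm, 'k::finite) kgraph \<Rightarrow> 'm kp_gen set" where
  "kp_gens \<Lambda> = Path ` Mor \<Lambda> \<union> star \<Lambda> ` Mor \<Lambda>"

text \<open>A relation \<open>x = y\<close> is represented by \<open>x - y\<close>.\<close>

definition KP1 :: "('o, 'm, 'k::finite) kgraph \<Rightarrow> ('K::field, 'm) kp_free set" where
  "KP1 \<Lambda> = {gen (Path l) * gen (Path m) -
       (if src \<Lambda> l = rng \<Lambda> m then gen (Path (cmp \<Lambda> l m)) else 0) | l m.
     l \<in> Mor \<Lambda> \<and> m \<in> Mor \<Lambda>}"

definition KP2 :: "('o, 'm, 'k::finite) kgraph \<Rightarrow> ('K::field, 'm) kp_free set" where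
  "KP2 \<Lambda> = {gen (star \<Lambda> m) * gen (star \<Lambda> l) -
       (if src \<Lambda> l = rng \<Lambda> m then gen (star \<Lambda> (cmp \<Lambda> l m)) else 0) | l m.
     l \<in> Mor \<Lambda> \<and> m \<in> Mor \<Lambda>}"

definition KP3 :: "('o, 'm, 'k::finite) kgraph \<Rightarrow> ('K::field, 'm) kp_free set" where
  "KP3 \<Lambda> = {gen (star \<Lambda> l) * gen (Path m) -
       (if l = m then gen (Path (idt \<Lambda> (src \<Lambda> l))) else 0) | l m.
     l \<in> Mor \<Lambda> \<and> m \<in> Mor \<Lambda> \<and> deg \<Lambda> l = deg \<Lambda> m}"

definition KP4 :: "('o, 'm, 'k::finite) kgraph \<Rightarrow> ('K::field, 'm) kp_free set" where
  "KP4 \<Lambda> = {(\<Sum>l\<in>with_rng_deg \<Lambda> v n. gen (Path l) * gen (star \<Lambda> l)) - gen (Path (idt \<Lambda> v)) | v n.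
     v \<in> Ob \<Lambda>}"

definition KP ::
  "('o, 'm, 'k::finite) kgraph \<Rightarrow> ('K::field, ('K, 'm) kp_free set) nu_algebra" where
  "KP \<Lambda> = presented_algebra (kp_gens \<Lambda>) (KP1 \<Lambda> \<union> KP2 \<Lambda> \<union> KP3 \<Lambda> \<union> KP4 \<Lambda>)"


section \<open>Modules over non-unital algebras\<close>

text \<open>The underlying vector space of a module is a subspace of an ambient vector space of
  type \<open>'v\<close>, from which it takes its addition.\<close>

record ('K, 'a, 'v) alg_module =
  mcarrier :: "'v set"
  mscale :: "'K \<Rightarrow> 'v \<Rightarrow> 'v"
  mact :: "'a \<Rightarrow> 'v \<Rightarrow> 'v"

definition left_module ::
  "('K::field, 'a) nu_algebra \<Rightarrow> ('K, 'a, 'v::ab_group_add) alg_module \<Rightarrow> bool" where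
  "left_module A M \<longleftrightarrow>
     vector_space (mscale M) \<and> module.subspace (mscale M) (mcarrier M) \<and>
     (\<forall>a\<in>acarrier A. \<forall>x\<in>mcarrier M. mact M a x \<in> mcarrier M) \<and>
     (\<forall>a\<in>acarrier A. \<forall>x\<in>mcarrier M. \<forall>y\<in>mcarrier M. mact M a (x + y) = mact M a x + mact M a y) \<and>
     (\<forall>a\<in>acarrier A. \<forall>c. \<forall>x\<in>mcarrier M. mact M a (mscale M c x) = mscale M c (mact M a x)) \<and>
     (\<forall>a\<in>acarrier A. \<forall>b\<in>acarrier A. \<forall>x\<in>mcarrier M. mact M (aadd A a b) x = mact M a x + mact M b x) \<and>
     (\<forall>c. \<forall>a\<in>acarrier A. \<forall>x\<in>mcarrier M. mact M (ascale A c a) x = mscale M c (mact M a x)) \<and>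
     (\<forall>a\<in>acarrier A. \<forall>b\<in>acarrier A. \<forall>x\<in>mcarrier M. mact M (amult A a b) x = mact M a (mact M b x))"

definition submodule ::
  "('K::field, 'a) nu_algebra \<Rightarrow> ('K, 'a, 'v::ab_group_add) alg_module \<Rightarrow> 'v set \<Rightarrow> bool" where
  "submodule A M W \<longleftrightarrow> W \<subseteq> mcarrier M \<and> module.subspace (mscale M) W \<and>
     (\<forall>a\<in>acarrier A. \<forall>x\<in>W. mact M a x \<in> W)"

definition indecomposable_module ::
  "('K::field, 'a) nu_algebra \<Rightarrow> ('K, 'a, 'v::ab_group_add) alg_module \<Rightarrow> bool" where
  "indecomposable_module A M \<longleftrightarrow> left_module A M \<and> mcarrier M \<noteq> {0} \<and>
     \<not> (\<exists>U W. submodule A M U \<and> submodule A M W \<and> U \<noteq> {0} \<and> W \<noteq> {0} \<and>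
          U \<inter> W = {0} \<and> {u + w | u w. u \<in> U \<and> w \<in> W} = mcarrier M)"


section \<open>The module $V_{(\Delta,\alpha)}$\<close>

definition lin_ext :: "('b \<Rightarrow> ('c \<Rightarrow>\<^sub>0 'K)) \<Rightarrow> ('b \<Rightarrow>\<^sub>0 'K::field) \<Rightarrow> ('c \<Rightarrow>\<^sub>0 'K)" where
  "lin_ext f x = (\<Sum>b\<in>Poly_Mapping.keys x. pm_scale (Poly_Mapping.lookup x b) (f b))"

fun basis_act :: "('o, 'm, 'p, 'n, 'k::finite) over \<Rightarrow> 'n kp_gen \<Rightarrow> 'o \<Rightarrow> ('o \<Rightarrow>\<^sub>0 'K::field)" where
  "basis_act (\<Delta>, \<alpha>) (Path l) v =
     (if \<exists>\<delta>\<in>with_src \<Delta> v. snd \<alpha> \<delta> = l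
      then Poly_Mapping.single (rng \<Delta> (THE \<delta>. \<delta> \<in> with_src \<Delta> v \<and> snd \<alpha> \<delta> = l)) 1 else 0)"
| "basis_act (\<Delta>, \<alpha>) (Ghost l) v =
     (if \<exists>\<delta>\<in>with_rng \<Delta> v. snd \<alpha> \<delta> = l
      then Poly_Mapping.single (src \<Delta> (THE \<delta>. \<delta> \<in> with_rng \<Delta> v \<and> snd \<alpha> \<delta> = l)) 1 else 0)"

text \<open>Action of the free algebra: the letters of a word act one after the other, the last one
  first.\<close>

definition free_act ::
  "('o, 'm, 'p, 'n, 'k::finite) over \<Rightarrow> ('K::field, 'n) kp_free \<Rightarrow> ('o \<Rightarrow>\<^sub>0 'K) \<Rightarrow> ('o \<Rightarrow>\<^sub>0 'K)" where
  "free_act X p x = lin_ext (\<lambda>w. foldr (\<lambda>g. lin_ext (basis_act X g)) (letters w) x) p"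

text \<open>An element of the presented algebra is a congruence class of elements of the free algebra,
  all of which act in the same way on the module.\<close>

definition rep_module :: "('o, 'm, 'p, 'n, 'k::finite) over \<Rightarrow>
    ('K::field, ('K, 'n) kp_free set, 'o \<Rightarrow>\<^sub>0 'K) alg_module" where
  "rep_module X = \<lparr>
     mcarrier = {x. Poly_Mapping.keys x \<subseteq> Ob (fst X)},
     mscale = pm_scale,
     mact = (\<lambda>A x. the_elem ((\<lambda>p. free_act X p x) ` A))\<rparr>"

end

theory Submission
  imports Defs
begin

text \<open>
  Unrolling \<open>\<Delta>\<close> over the integers (a connected component of the skew product of \<open>\<Delta>\<close> with
  $\mathbb{Z}$ along the degree) gives a covering whose vertices carry a height that every path
  raises by its degree; the universal covering \<open>\<Omega>\<close> maps to it and inherits the height \<open>h\<close>.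
  Any two vertices of \<open>\<Omega>\<close> have a common source, so a vertex is determined by its height and the
  images in \<open>\<Lambda>\<close> of the paths ending in it.

  A decomposition of the module is an idempotent endomorphism $f$. As $f$ commutes with all
  $\lambda\lambda^*$, the support of $f(v)$ consists of vertices whose incoming paths have the
  same images as those of $v$, so $f(v)$ can be recovered from its image in the Laurent polynomials
  under $u \mapsto x^{h(u)}$. As $f$ commutes with the ghost paths and \<open>\<Omega>\<close> is connected, $f$
  becomes multiplication by a fixed Laurent polynomial $c$ with $c^2 = c$; hence $c$ is 0 or 1 and
  $f$ is zero or the identity.
\<close>

section \<open>Linear extension and the action of the free algebra\<close>

lemma lookup_pm_scale [simp]:
  "Poly_Mapping.lookup (pm_scale c x) k = c * Poly_Mapping.lookup x k"
  by (simp add: pm_scale_def Poly_Mapping.map.rep_eq when_def)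

lemma vector_space_pm_scale: "vector_space pm_scale"
  by unfold_locales (auto intro!: poly_mapping_eqI simp: lookup_add algebra_simps)

interpretation pm: vector_space pm_scale
  by (rule vector_space_pm_scale)

lemma pm_scale_single [simp]:
  "pm_scale c (Poly_Mapping.single k a) = Poly_Mapping.single k (c * a)"
  by (rule poly_mapping_eqI) (simp add: lookup_single when_def)

lemma pm_scale_mult_left: "pm_scale c (p :: 'a::monoid_add \<Rightarrow>\<^sub>0 'K::field) * q = pm_scale c (p * q)"
  by (simp add: pm_scale_def mult_map_scale_conv_mult mult.assoc)

text \<open>A scalar acts as a multiple of the neutral word. Such multiples are central although the
  word monoid need not be commutative, because the field is.\<close>

lemma pm_scale_mult_right: "p * pm_scale c q = pm_scale c (p * q)"
  for p :: "'a::monoid_add \<Rightarrow>\<^sub>0 'K::field"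
proof -
  have "p * Poly_Mapping.single 0 c = Poly_Mapping.single 0 c * p"
  proof (induction p rule: update_induct)
    case (update f a b)
    have "Poly_Mapping.update a b f = f + Poly_Mapping.single a b"
      using update(1) by (intro poly_mapping_eqI)
        (auto simp: lookup_update lookup_add lookup_single when_def in_keys_iff)
    with update show ?case
      by (simp add: distrib_left distrib_right mult_single mult.commute)
  qed simp
  then show ?thesis
    by (simp add: pm_scale_def mult_map_scale_conv_mult mult.assoc[symmetric])
qed

lemma lin_ext_eq_sum:
  assumes "finite B" "Poly_Mapping.keys x \<subseteq> B"
  shows "lin_ext f x = (\<Sum>b\<in>B. pm_scale (Poly_Mapping.lookup x b) (f b))"
  unfolding lin_ext_def
  by (rule sum.mono_neutral_left) (use assms in \<open>auto simp: in_keys_iff\<close>)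

lemma lin_ext_add: "lin_ext f (x + y) = lin_ext f x + lin_ext f y"
proof -
  let ?B = "Poly_Mapping.keys x \<union> Poly_Mapping.keys y"
  have "Poly_Mapping.keys (x + y) \<subseteq> ?B"
    by (rule keys_add)
  then show ?thesis
    by (simp add: lin_ext_eq_sum[of ?B] lookup_add pm.scale_left_distrib sum.distrib)
qed

lemma lin_ext_scale: "lin_ext f (pm_scale c x) = pm_scale c (lin_ext f x)"
proof -
  have "Poly_Mapping.keys (pm_scale c x) \<subseteq> Poly_Mapping.keys x"
    by (auto simp: in_keys_iff)
  then show ?thesis
    by (simp add: lin_ext_eq_sum[of "Poly_Mapping.keys x"] pm.scale_sum_right)
qed

lemma module_hom_lin_ext: "module_hom pm_scale pm_scale (lin_ext f)"
  by unfold_locales (simp_all add: lin_ext_add lin_ext_scale)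

lemma lin_ext_zero [simp]: "lin_ext f 0 = 0"
  by (simp add: lin_ext_def)

lemma lin_ext_diff: "lin_ext f (x - y) = lin_ext f x - lin_ext f y"
  by (rule module_hom.diff[OF module_hom_lin_ext])

lemma lin_ext_sum: "lin_ext f (sum g A) = (\<Sum>a\<in>A. lin_ext f (g a))"
  by (rule module_hom.sum[OF module_hom_lin_ext])

lemma lin_ext_single [simp]: "lin_ext f (Poly_Mapping.single b c) = pm_scale c (f b)"
  by (simp add: lin_ext_def)

lemma lin_ext_cong:
  assumes "\<And>b. b \<in> Poly_Mapping.keys x \<Longrightarrow> f b = g b"
  shows "lin_ext f x = lin_ext g x"
  unfolding lin_ext_def by (rule sum.cong) (simp_all add: assms)

lemma lookup_lin_ext:
  "Poly_Mapping.lookup (lin_ext f x) k =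
   (\<Sum>b\<in>Poly_Mapping.keys x. Poly_Mapping.lookup x b * Poly_Mapping.lookup (f b) k)"
  by (simp add: lin_ext_def lookup_sum)

lemma sum_singles:
  "(\<Sum>b\<in>Poly_Mapping.keys x. pm_scale (Poly_Mapping.lookup x b) (Poly_Mapping.single b 1)) = x"
  by (rule poly_mapping_eqI)
    (simp add: lookup_sum lookup_single when_def sum.delta in_keys_iff)

lemma module_hom_eq_lin_ext:
  assumes "module_hom pm_scale pm_scale F"
  shows "F x = lin_ext (\<lambda>b. F (Poly_Mapping.single b 1)) x"
proof -
  have "F x = F (\<Sum>b\<in>Poly_Mapping.keys x.
      pm_scale (Poly_Mapping.lookup x b) (Poly_Mapping.single b 1))"
    by (simp only: sum_singles)
  also have "\<dots> = (\<Sum>b\<in>Poly_Mapping.keys x.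
      pm_scale (Poly_Mapping.lookup x b) (F (Poly_Mapping.single b 1)))"
    by (simp only: module_hom.sum[OF assms] module_hom.scale[OF assms])
  finally show ?thesis by (simp add: lin_ext_def)
qed

text \<open>Two linear maps are compared on the basis vectors in the support of \<open>x\<close>
  alone, so that facts about vertices of the graph can be applied to every vector of the
  carrier.\<close>

lemma module_hom_eq_on_keys:
  assumes "module_hom pm_scale pm_scale F" "module_hom pm_scale pm_scale G"
    and "\<And>b. b \<in> Poly_Mapping.keys x \<Longrightarrow> F (Poly_Mapping.single b 1) = G (Poly_Mapping.single b 1)"
  shows "F x = G x"
  using module_hom_eq_lin_ext[OF assms(1), of x] module_hom_eq_lin_ext[OF assms(2), of x]
  by (simp add: lin_ext_cong[OF assms(3)])

lemma keys_lin_ext_subset: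
  assumes "\<And>b. b \<in> Poly_Mapping.keys x \<Longrightarrow> Poly_Mapping.keys (f b) \<subseteq> S"
  shows "Poly_Mapping.keys (lin_ext f x) \<subseteq> S"
proof
  fix k assume "k \<in> Poly_Mapping.keys (lin_ext f x)"
  then obtain b where "b \<in> Poly_Mapping.keys x" "Poly_Mapping.lookup (f b) k \<noteq> 0"
    by (force simp: in_keys_iff lookup_lin_ext elim: sum.not_neutral_contains_not_neutral)
  with assms[of b] show "k \<in> S" by (auto simp: in_keys_iff)
qed

section \<open>Words and elements of the free algebra as linear maps\<close>

definition word_act ::
  "('o, 'm, 'p, 'n, 'k::finite) over \<Rightarrow> 'n kp_gen word \<Rightarrow> ('o \<Rightarrow>\<^sub>0 'K::field) \<Rightarrow> ('o \<Rightarrow>\<^sub>0 'K)" where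
  "word_act X w = foldr (\<lambda>g. lin_ext (basis_act X g)) (letters w)"

lemma free_act_eq: "free_act X p x = lin_ext (\<lambda>w. word_act X w x) p"
  by (simp add: free_act_def word_act_def)

lemma word_act_plus: "word_act X (u + w) x = word_act X u (word_act X w x)"
  by (simp add: word_act_def plus_word_def)

lemma module_hom_word_act: "module_hom pm_scale pm_scale (word_act X w)"
proof -
  have "module_hom pm_scale pm_scale (foldr (\<lambda>g. lin_ext (basis_act X g)) gs)" for gs
    by (induction gs) (unfold_locales, simp_all add: module_hom.add module_hom.scale lin_ext_add lin_ext_scale)
  then show ?thesis by (simp add: word_act_def)
qed

lemma module_hom_free_act: "module_hom pm_scale pm_scale (free_act X p)"
  by unfold_locales
    (simp_all add: free_act_eq lin_ext_def module_hom.add[OF module_hom_word_act]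
      module_hom.scale[OF module_hom_word_act] pm.scale_right_distrib sum.distrib
      pm.scale_sum_right mult.commute)

lemmas free_act_add_right = module_hom.add[OF module_hom_free_act]
  and free_act_scale_right = module_hom.scale[OF module_hom_free_act]

lemma free_act_add: "free_act X (p + q) x = free_act X p x + free_act X q x"
  and free_act_diff: "free_act X (p - q) x = free_act X p x - free_act X q x"
  and free_act_scale: "free_act X (pm_scale c p) x = pm_scale c (free_act X p x)"
  and free_act_sum: "free_act X (sum P A) x = (\<Sum>a\<in>A. free_act X (P a) x)"
  and free_act_zero [simp]: "free_act X 0 x = 0"
  by (simp_all add: free_act_eq lin_ext_add lin_ext_diff lin_ext_scale lin_ext_sum)

lemma free_act_gen: "free_act X (gen g) x = lin_ext (basis_act X g) x"
  by (simp add: free_act_eq gen_def word_act_def)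

text \<open>Both sides are linear in \<open>p\<close> and in \<open>q\<close>, and for two words a
  concatenation acts as the composite of the actions.\<close>

lemma free_act_mult: "free_act X (p * q) x = free_act X p (free_act X q x)"
proof -
  \<comment> \<open>First the left factor is a single word, and linearity in \<open>q\<close>
    reduces the right factor to a word as well.\<close>
  have single: "free_act X (Poly_Mapping.single u 1 * q) x = word_act X u (free_act X q x)" for u
  proof (rule module_hom_eq_on_keys[where F = "\<lambda>q. free_act X (Poly_Mapping.single u 1 * q) x"
        and G = "\<lambda>q. word_act X u (free_act X q x)"])
    show "module_hom pm_scale pm_scale (\<lambda>q. free_act X (Poly_Mapping.single u 1 * q) x)"
      by unfold_locales
        (simp_all add: distrib_left free_act_add free_act_scale pm_scale_mult_right)
    show "module_hom pm_scale pm_scale (\<lambda>q. word_act X u (free_act X q x))"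
      by unfold_locales (simp_all add: free_act_add free_act_scale
          module_hom.add[OF module_hom_word_act] module_hom.scale[OF module_hom_word_act])
  qed (simp add: mult_single free_act_eq word_act_plus)
  show ?thesis
  proof (rule module_hom_eq_on_keys[where F = "\<lambda>p. free_act X (p * q) x"
        and G = "\<lambda>p. free_act X p (free_act X q x)"])
    show "module_hom pm_scale pm_scale (\<lambda>p. free_act X (p * q) x)"
      by unfold_locales
        (simp_all add: distrib_right free_act_add free_act_scale pm_scale_mult_left)
    show "module_hom pm_scale pm_scale (\<lambda>p. free_act X p (free_act X q x))"
      by unfold_locales (simp_all add: free_act_add free_act_scale)
  qed (simp only: single, simp add: free_act_eq)
qed

section \<open>The Kumjian-Pask relations on a representation graph\<close>

declare basis_act.simps [simp del]

section \<open>Consequences of unique factorization and of connectedness\<close>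

context k_graph
begin

lemma factorization_cancel:
  assumes "g \<in> Mor G" "h \<in> Mor G" "src G g = rng G h"
    and "g' \<in> Mor G" "h' \<in> Mor G" "src G g' = rng G h'"
    and "deg G g = deg G g'" "deg G h = deg G h'" "cmp G g h = cmp G g' h'"
  shows "g = g'" "h = h'"
proof -
  have "cmp G g h \<in> Mor G" "deg G (cmp G g h) = deg G g + deg G h"
    using assms by (simp_all add: cmp_in deg_cmp)
  from factorization[OF this] obtain z where "\<And>a b. \<lbrakk>a \<in> Mor G; b \<in> Mor G; src G a = rng G b;
      deg G a = deg G g; deg G b = deg G h; cmp G g h = cmp G a b\<rbrakk> \<Longrightarrow> (a, b) = z"
    by (auto elim!: ex1E)
  from this[of g h] this[of g' h'] have "(g, h) = (g', h')"
    using assms by simp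
  then show "g = g'" "h = h'" by auto
qed

lemma factorizationE:
  assumes "f \<in> Mor G" "deg G f = m + n"
  obtains g h where "g \<in> Mor G" "h \<in> Mor G" "src G g = rng G h"
    "deg G g = m" "deg G h = n" "f = cmp G g h"
  using factorization[OF assms] by blast

text \<open>Composing \<open>f\<close> with an identity on either side gives two factorizations of
  \<open>f\<close> into factors of degree 0. Uniqueness identifies their first factors.\<close>

lemma deg_zero_eq_idt:
  assumes "f \<in> Mor G" "deg G f = 0"
  shows "f = idt G (rng G f)"
proof (rule factorization_cancel(1)[of f "idt G (src G f)" _ f])
  show "cmp G f (idt G (src G f)) = cmp G (idt G (rng G f)) f"
    using assms by (simp add: cmp_idt idt_cmp)
qed (use assms in \<open>simp_all add: src_in rng_in idt_in src_idt rng_idt deg_idt\<close>)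

text \<open>Connectedness as an induction principle: to relate any two vertices, it suffices to
  exhibit an equivalence relation that contains all edges.\<close>

lemma generated_equiv_ObD:
  assumes "equiv (Ob G) E" "\<And>f. f \<in> Mor G \<Longrightarrow> (rng G f, src G f) \<in> E"
    and "u \<in> Ob G" "v \<in> Ob G"
  shows "(u, v) \<in> E"
proof -
  have "(u, v) \<in> connected_rel G" using connected assms(3,4) by simp
  then show ?thesis
    using assms(1,2) by (auto simp: connected_rel_def generated_equiv_def)
qed

end

text \<open>The parameter \<open>scalars\<close> only fixes the coefficient field throughout the locale.\<close>

locale representation_kgraph =
  fixes \<Lambda> :: "('p, 'n, 'k::finite) kgraph" and \<Delta> :: "('o, 'm, 'k) kgraph" and \<alpha>
    and scalars :: "'K::field itself"
  assumes base: "k_graph \<Lambda>" and rep: "rep_kgraph \<Lambda> (\<Delta>, \<alpha>)"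
begin

sublocale L: k_graph \<Lambda> by (rule base)

sublocale D: k_graph \<Delta> using rep by (simp add: rep_kgraph_def)

abbreviation "av \<equiv> fst \<alpha>"
abbreviation "am \<equiv> snd \<alpha>"

lemma mor: "kgraph_mor \<Delta> \<Lambda> \<alpha>"
  using rep by (simp add: rep_kgraph_def)

lemma am_in: "f \<in> Mor \<Delta> \<Longrightarrow> am f \<in> Mor \<Lambda>"
  and src_am: "f \<in> Mor \<Delta> \<Longrightarrow> src \<Lambda> (am f) = av (src \<Delta> f)"
  and rng_am: "f \<in> Mor \<Delta> \<Longrightarrow> rng \<Lambda> (am f) = av (rng \<Delta> f)"
  and deg_am: "f \<in> Mor \<Delta> \<Longrightarrow> deg \<Lambda> (am f) = deg \<Delta> f"
  and am_idt: "v \<in> Ob \<Delta> \<Longrightarrow> am (idt \<Delta> v) = idt \<Lambda> (av v)"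
  and am_cmp: "\<lbrakk>f \<in> Mor \<Delta>; g \<in> Mor \<Delta>; src \<Delta> f = rng \<Delta> g\<rbrakk>
    \<Longrightarrow> am (cmp \<Delta> f g) = cmp \<Lambda> (am f) (am g)"
  using mor by (auto simp: kgraph_mor_def PiE_def Pi_def)

section \<open>Unique lifting of paths along \<alpha>\<close>

lemma am_src_inj:
  assumes "f \<in> Mor \<Delta>" "g \<in> Mor \<Delta>" "src \<Delta> f = src \<Delta> g" "am f = am g"
  shows "f = g"
proof -
  have "bij_betw am (with_src \<Delta> (src \<Delta> g)) (with_src \<Lambda> (av (src \<Delta> g)))"
    using rep assms D.src_in by (simp add: rep_kgraph_def)
  then show ?thesis
    using assms by (auto simp: bij_betw_def inj_on_def with_src_def)
qed

lemma am_src_lift: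
  assumes "l \<in> Mor \<Lambda>" "v \<in> Ob \<Delta>" "src \<Lambda> l = av v"
  obtains f where "f \<in> Mor \<Delta>" "src \<Delta> f = v" "am f = l"
proof -
  have "am ` with_src \<Delta> v = with_src \<Lambda> (av v)"
    using rep assms by (auto simp: rep_kgraph_def bij_betw_def)
  moreover have "l \<in> with_src \<Lambda> (av v)" using assms by (simp add: with_src_def)
  ultimately have "l \<in> am ` with_src \<Delta> v" by simp
  then show thesis using that by (auto simp: with_src_def)
qed

lemma rng_deg_unique:
  assumes "f \<in> Mor \<Delta>" "g \<in> Mor \<Delta>" "rng \<Delta> f = rng \<Delta> g" "deg \<Delta> f = deg \<Delta> g"
  shows "f = g"
proof -
  obtain e where "with_rng_deg \<Delta> (rng \<Delta> g) (deg \<Delta> g) = {e}"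
    using rep assms D.rng_in by (force simp: rep_kgraph_def)
  moreover have "f \<in> with_rng_deg \<Delta> (rng \<Delta> g) (deg \<Delta> g)" "g \<in> with_rng_deg \<Delta> (rng \<Delta> g) (deg \<Delta> g)"
    using assms by (simp_all add: with_rng_deg_def with_rng_def)
  ultimately show ?thesis by auto
qed

lemma rng_deg_ex:
  assumes "v \<in> Ob \<Delta>"
  obtains f where "f \<in> Mor \<Delta>" "rng \<Delta> f = v" "deg \<Delta> f = n"
  using D.no_sources[OF assms, of n] by (auto simp: with_rng_deg_def with_rng_def)

text \<open>Bijectivity is assumed for paths with a given source. For a given range, equal images
  force equal degrees, and a vertex receives exactly one path of each degree.\<close>

lemma am_rng_inj:
  assumes "f \<in> Mor \<Delta>" "g \<in> Mor \<Delta>" "rng \<Delta> f = rng \<Delta> g" "am f = am g"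
  shows "f = g"
  using assms by (intro rng_deg_unique) (simp_all flip: deg_am)

section \<open>Action of the generators on vertices\<close>

abbreviation act :: "'n kp_gen \<Rightarrow> 'o \<Rightarrow> ('o \<Rightarrow>\<^sub>0 'K)" where
  "act \<equiv> basis_act (\<Delta>, \<alpha>)"

lemma act_Path:
  assumes "f \<in> Mor \<Delta>" "am f = l" "src \<Delta> f = v"
  shows "act (Path l) v = Poly_Mapping.single (rng \<Delta> f) 1"
proof -
  have "(THE d. d \<in> with_src \<Delta> v \<and> am d = l) = f"
    using assms by (intro the_equality) (auto simp: with_src_def intro: am_src_inj)
  then show ?thesis using assms by (auto simp: with_src_def basis_act.simps)
qed

lemma act_Path_zero:
  assumes "src \<Lambda> l \<noteq> av v"
  shows "act (Path l) v = 0"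
  using assms by (auto simp: basis_act.simps with_src_def src_am)

lemma act_Ghost:
  assumes "f \<in> Mor \<Delta>" "am f = l" "rng \<Delta> f = v"
  shows "act (Ghost l) v = Poly_Mapping.single (src \<Delta> f) 1"
proof -
  have "(THE d. d \<in> with_rng \<Delta> v \<and> am d = l) = f"
    using assms by (intro the_equality) (auto simp: with_rng_def intro: am_rng_inj)
  then show ?thesis using assms by (auto simp: with_rng_def basis_act.simps)
qed

lemma act_Ghost_zero:
  assumes "\<And>f. \<lbrakk>f \<in> Mor \<Delta>; rng \<Delta> f = v\<rbrakk> \<Longrightarrow> am f \<noteq> l"
  shows "act (Ghost l) v = 0"
  using assms by (auto simp: with_rng_def basis_act.simps)

lemma act_Ghost_rng_zero:
  assumes "rng \<Lambda> l \<noteq> av v"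
  shows "act (Ghost l) v = 0"
  using assms by (intro act_Ghost_zero) (auto simp: rng_am)

lemma act_idt:
  assumes "u \<in> Ob \<Lambda>" "v \<in> Ob \<Delta>"
  shows "act (Path (idt \<Lambda> u)) v = (if av v = u then Poly_Mapping.single v 1 else 0)"
    and "act (Ghost (idt \<Lambda> u)) v = (if av v = u then Poly_Mapping.single v 1 else 0)"
proof -
  show "act (Path (idt \<Lambda> u)) v = (if av v = u then Poly_Mapping.single v 1 else 0)"
    using assms act_Path[of "idt \<Delta> v" "idt \<Lambda> u" v] act_Path_zero[of "idt \<Lambda> u" v]
    by (auto simp: am_idt D.idt_in D.src_idt D.rng_idt L.src_idt)
  show "act (Ghost (idt \<Lambda> u)) v = (if av v = u then Poly_Mapping.single v 1 else 0)"
    using assms act_Ghost[of "idt \<Delta> v" "idt \<Lambda> u" v] act_Ghost_rng_zero[of "idt \<Lambda> u" v]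
    by (auto simp: am_idt D.idt_in D.src_idt D.rng_idt L.rng_idt)
qed

text \<open>In degree 0 the symbol \<open>star \<Lambda> l\<close> is the path \<open>l\<close>
  itself, which is an identity, and identities act in the same way as paths and as ghosts. This
  allows all starred generators to be treated as \<open>Ghost\<close> letters.\<close>

lemma act_star:
  assumes "l \<in> Mor \<Lambda>" "v \<in> Ob \<Delta>"
  shows "act (star \<Lambda> l) v = act (Ghost l) v"
proof (cases "deg \<Lambda> l = 0")
  case True
  then obtain u where "u \<in> Ob \<Lambda>" "l = idt \<Lambda> u"
    using L.deg_zero_eq_idt L.rng_in assms by metis
  then show ?thesis using True assms by (simp add: star_def act_idt)
qed (simp add: star_def)

definition carr :: "('o \<Rightarrow>\<^sub>0 'K) set" where
  "carr = {x. Poly_Mapping.keys x \<subseteq> Ob \<Delta>}"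

lemma single_in_carr: "v \<in> Ob \<Delta> \<Longrightarrow> Poly_Mapping.single v c \<in> carr"
  by (simp add: carr_def)

lemma subspace_carr: "module.subspace pm_scale carr"
proof (rule pm.subspaceI)
  fix x y :: "'o \<Rightarrow>\<^sub>0 'K" and c
  assume x: "x \<in> carr"
  show "x + y \<in> carr" if "y \<in> carr" using x that keys_add[of x y] by (auto simp: carr_def)
  show "pm_scale c x \<in> carr" using x by (auto simp: carr_def in_keys_iff)
qed (simp add: carr_def)

lemma act_in_carr:
  assumes "v \<in> Ob \<Delta>"
  shows "act g v \<in> carr"
proof (cases g)
  case (Path l)
  consider f where "f \<in> Mor \<Delta>" "am f = l" "src \<Delta> f = v" | "act (Path l) v = 0"
    by (metis (mono_tags, lifting) basis_act.simps with_src_def mem_Collect_eq snd_conv)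
  then show ?thesis
    by cases (simp_all add: Path act_Path single_in_carr D.rng_in, simp add: carr_def)
next
  case (Ghost l)
  consider f where "f \<in> Mor \<Delta>" "am f = l" "rng \<Delta> f = v" | "act (Ghost l) v = 0"
    by (metis (mono_tags, lifting) basis_act.simps with_rng_def mem_Collect_eq snd_conv)
  then show ?thesis
    by cases (simp_all add: Ghost act_Ghost single_in_carr D.src_in, simp add: carr_def)
qed

lemma lin_ext_act_in_carr: "x \<in> carr \<Longrightarrow> lin_ext (act g) x \<in> carr"
  using act_in_carr keys_lin_ext_subset[of x "act g" "Ob \<Delta>"] by (auto simp: carr_def)

lemma free_act_in_carr:
  assumes "x \<in> carr"
  shows "free_act (\<Delta>, \<alpha>) p x \<in> carr"
proof -
  have "foldr (\<lambda>g. lin_ext (act g)) gs x \<in> carr" for gs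
    using assms by (induction gs) (simp_all add: lin_ext_act_in_carr)
  then show ?thesis
    using keys_lin_ext_subset[of p "\<lambda>w. word_act (\<Delta>, \<alpha>) w x" "Ob \<Delta>"]
    by (auto simp: free_act_eq carr_def word_act_def)
qed

definition annihilates where
  "annihilates p \<longleftrightarrow> (\<forall>x\<in>carr. free_act (\<Delta>, \<alpha>) p x = 0)" for p :: "('K, 'n) kp_free"

lemma annihilatesI:
  assumes "\<And>v. v \<in> Ob \<Delta> \<Longrightarrow> free_act (\<Delta>, \<alpha>) p (Poly_Mapping.single v 1) = 0"
  shows "annihilates p"
  unfolding annihilates_def
proof
  fix x :: "'o \<Rightarrow>\<^sub>0 'K" assume "x \<in> carr"
  then have "free_act (\<Delta>, \<alpha>) p x = lin_ext (\<lambda>b. 0) x"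
    unfolding module_hom_eq_lin_ext[OF module_hom_free_act, of _ _ x]
    using assms by (intro lin_ext_cong) (auto simp: carr_def)
  then show "free_act (\<Delta>, \<alpha>) p x = 0" by (simp add: lin_ext_def)
qed

section \<open>The four families of Kumjian-Pask relations on basis vectors\<close>

lemma Path_mult:
  assumes "l \<in> Mor \<Lambda>" "m \<in> Mor \<Lambda>" "v \<in> Ob \<Delta>"
  shows "lin_ext (act (Path l)) (act (Path m) v) =
    (if src \<Lambda> l = rng \<Lambda> m then act (Path (cmp \<Lambda> l m)) v else 0)"
proof (cases "src \<Lambda> m = av v")
  case True
  then obtain f where f: "f \<in> Mor \<Delta>" "src \<Delta> f = v" "am f = m"
    using assms am_src_lift by metis
  have m: "act (Path m) v = Poly_Mapping.single (rng \<Delta> f) 1"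
    by (rule act_Path) (use f in auto)
  show ?thesis
  proof (cases "src \<Lambda> l = rng \<Lambda> m")
    case True
    then obtain g where g: "g \<in> Mor \<Delta>" "src \<Delta> g = rng \<Delta> f" "am g = l"
      using assms am_src_lift[of l "rng \<Delta> f"] D.rng_in f rng_am by metis
    have "act (Path l) (rng \<Delta> f) = Poly_Mapping.single (rng \<Delta> g) 1"
      by (rule act_Path) (use g in auto)
    moreover have "act (Path (cmp \<Lambda> l m)) v = Poly_Mapping.single (rng \<Delta> (cmp \<Delta> g f)) 1"
      by (rule act_Path) (use f g in \<open>auto simp: D.cmp_in am_cmp D.src_cmp\<close>)
    ultimately show ?thesis using m True f g by (simp add: D.rng_cmp)
  next
    case False
    then have "act (Path l) (rng \<Delta> f) = 0"
      using f rng_am by (intro act_Path_zero) auto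
    then show ?thesis using m False by simp
  qed
next
  case False
  then show ?thesis
    using assms act_Path_zero[of m v] act_Path_zero[of "cmp \<Lambda> l m" v]
    by (auto simp: L.src_cmp)
qed

text \<open>Factor \<open>e\<close> in \<Delta> according to the degrees of \<open>l\<close> and
  \<open>m\<close>. The images of the factors compose to the same path of \<Lambda> with the same
  degrees, so they are \<open>l\<close> and \<open>m\<close>.\<close>

lemma am_eq_cmpE:
  assumes "e \<in> Mor \<Delta>" "am e = cmp \<Lambda> l m"
    and "l \<in> Mor \<Lambda>" "m \<in> Mor \<Lambda>" "src \<Lambda> l = rng \<Lambda> m"
  obtains g h where "g \<in> Mor \<Delta>" "h \<in> Mor \<Delta>" "src \<Delta> g = rng \<Delta> h" "e = cmp \<Delta> g h"
    "am g = l" "am h = m"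
proof -
  have "deg \<Delta> e = deg \<Lambda> l + deg \<Lambda> m"
    using deg_am[of e] assms by (simp add: L.deg_cmp)
  from D.factorizationE[OF assms(1) this] obtain g h where gh: "g \<in> Mor \<Delta>" "h \<in> Mor \<Delta>"
    "src \<Delta> g = rng \<Delta> h" "deg \<Delta> g = deg \<Lambda> l" "deg \<Delta> h = deg \<Lambda> m" "e = cmp \<Delta> g h" by blast
  have "am g = l" "am h = m"
    by (rule L.factorization_cancel[of "am g" "am h" l m];
      use gh assms in \<open>simp add: am_in src_am rng_am deg_am am_cmp\<close>)+
  then show thesis using that gh by blast
qed

text \<open>A path of \<Lambda> need not lift to a path with prescribed range. Where one of the two
  ghosts acts as zero, \<open>am_eq_cmpE\<close> shows that the composite has no lift either, since
  a lift would split into lifts of both factors.\<close>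

lemma Ghost_mult:
  assumes "l \<in> Mor \<Lambda>" "m \<in> Mor \<Lambda>" "v \<in> Ob \<Delta>"
  shows "lin_ext (act (Ghost m)) (act (Ghost l) v) =
    (if src \<Lambda> l = rng \<Lambda> m then act (Ghost (cmp \<Lambda> l m)) v else 0)"
proof (cases "\<exists>f\<in>Mor \<Delta>. am f = l \<and> rng \<Delta> f = v")
  case True
  then obtain f where f: "f \<in> Mor \<Delta>" "rng \<Delta> f = v" "am f = l" by blast
  have l: "act (Ghost l) v = Poly_Mapping.single (src \<Delta> f) 1"
    by (rule act_Ghost) (use f in auto)
  show ?thesis
  proof (cases "src \<Lambda> l = rng \<Lambda> m")
    case comp: True
    show ?thesis
    proof (cases "\<exists>g\<in>Mor \<Delta>. am g = m \<and> rng \<Delta> g = src \<Delta> f")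
      case True
      then obtain g where g: "g \<in> Mor \<Delta>" "rng \<Delta> g = src \<Delta> f" "am g = m" by blast
      have "act (Ghost m) (src \<Delta> f) = Poly_Mapping.single (src \<Delta> g) 1"
        by (rule act_Ghost) (use g in auto)
      moreover have "act (Ghost (cmp \<Lambda> l m)) v = Poly_Mapping.single (src \<Delta> (cmp \<Delta> f g)) 1"
        by (rule act_Ghost) (use f g in \<open>auto simp: D.cmp_in am_cmp D.rng_cmp\<close>)
      ultimately show ?thesis using comp l f g by (simp add: D.src_cmp)
    next
      case False
      then have "act (Ghost m) (src \<Delta> f) = 0" by (intro act_Ghost_zero) blast
      moreover have "act (Ghost (cmp \<Lambda> l m)) v = 0"
      proof (rule act_Ghost_zero)
        fix e assume e: "e \<in> Mor \<Delta>" "rng \<Delta> e = v"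
        show "am e \<noteq> cmp \<Lambda> l m"
        proof
          assume eq: "am e = cmp \<Lambda> l m"
          obtain g h where gh: "g \<in> Mor \<Delta>" "h \<in> Mor \<Delta>" "src \<Delta> g = rng \<Delta> h"
            "e = cmp \<Delta> g h" "am g = l" "am h = m"
            by (rule am_eq_cmpE[OF e(1) eq assms(1,2) comp])
          then have "g = f"
            using f e by (intro am_rng_inj) (auto simp: D.rng_cmp)
          then show False using False gh by auto
        qed
      qed
      ultimately show ?thesis using comp l by simp
    qed
  next
    case False
    then have "act (Ghost m) (src \<Delta> f) = 0"
      using f src_am by (intro act_Ghost_rng_zero) auto
    then show ?thesis using l False by simp
  qed
next
  case False
  have "act (Ghost l) v = 0" using False by (intro act_Ghost_zero) blast
  moreover have "act (Ghost (cmp \<Lambda> l m)) v = 0" if comp: "src \<Lambda> l = rng \<Lambda> m"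
  proof (rule act_Ghost_zero)
    fix e assume e: "e \<in> Mor \<Delta>" "rng \<Delta> e = v"
    show "am e \<noteq> cmp \<Lambda> l m"
    proof
      assume eq: "am e = cmp \<Lambda> l m"
      obtain g h where "g \<in> Mor \<Delta>" "h \<in> Mor \<Delta>" "src \<Delta> g = rng \<Delta> h"
        "e = cmp \<Delta> g h" "am g = l" "am h = m"
        by (rule am_eq_cmpE[OF e(1) eq assms(1,2) comp])
      then show False using False e D.rng_cmp by auto
    qed
  qed
  ultimately show ?thesis by simp
qed

text \<open>If \<open>f\<close> lifts \<open>m\<close> at \<open>v\<close>, then \<open>f\<close> is
  the only path of its degree into its range. A ghost of that degree therefore acts there as zero
  unless it is the ghost of \<open>m\<close>, which leads back to \<open>v\<close>.\<close>

lemma Ghost_Path: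
  assumes "l \<in> Mor \<Lambda>" "m \<in> Mor \<Lambda>" "deg \<Lambda> l = deg \<Lambda> m" "v \<in> Ob \<Delta>"
  shows "lin_ext (act (Ghost l)) (act (Path m) v) =
    (if l = m then act (Path (idt \<Lambda> (src \<Lambda> l))) v else 0)"
proof (cases "src \<Lambda> m = av v")
  case True
  then obtain f where f: "f \<in> Mor \<Delta>" "src \<Delta> f = v" "am f = m"
    using assms am_src_lift by metis
  have m: "act (Path m) v = Poly_Mapping.single (rng \<Delta> f) 1"
    by (rule act_Path) (use f in auto)
  show ?thesis
  proof (cases "l = m")
    case True
    have "act (Ghost m) (rng \<Delta> f) = Poly_Mapping.single v 1"
      using act_Ghost[of f m "rng \<Delta> f"] f by simp
    then show ?thesis
      using True m \<open>src \<Lambda> m = av v\<close> act_idt(1)[OF L.src_in[OF assms(1)] assms(4)]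
      by simp
  next
    case False
    have "act (Ghost l) (rng \<Delta> f) = 0"
    proof (rule act_Ghost_zero)
      fix e assume "e \<in> Mor \<Delta>" "rng \<Delta> e = rng \<Delta> f"
      then show "am e \<noteq> l"
        using False f assms(3) rng_deg_unique[of e f] deg_am[of e] deg_am[of f] by auto
    qed
    then show ?thesis using False m by simp
  qed
next
  case False
  then show ?thesis
    using assms act_Path_zero[of m v] act_idt(1)[of "src \<Lambda> m" v] L.src_in
    by auto
qed

text \<open>The product of a path and its ghost projects onto the vertices into which the path
  lifts. It serves for the fourth relation and, later, for bounding the supports of
  endomorphisms.\<close>

lemma Path_Ghost:
  assumes "f \<in> Mor \<Delta>" "v \<in> Ob \<Delta>"
  shows "lin_ext (act (Path (am f))) (act (Ghost (am f)) v) =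
    (if \<exists>g\<in>Mor \<Delta>. rng \<Delta> g = v \<and> am g = am f then Poly_Mapping.single v 1 else 0)"
proof (cases "\<exists>g\<in>Mor \<Delta>. rng \<Delta> g = v \<and> am g = am f")
  case True
  then obtain g where g: "g \<in> Mor \<Delta>" "rng \<Delta> g = v" "am g = am f" by blast
  then show ?thesis
    using True act_Ghost[of g "am f" v] act_Path[of g "am f" "src \<Delta> g"]
    by simp
next
  case False
  then have "act (Ghost (am f)) v = 0" by (intro act_Ghost_zero) blast
  then show ?thesis using False by auto
qed

text \<open>Only one path of degree \<open>n\<close> ends in \<open>v\<close>, so at most one
  summand survives, namely the one for its image in \<Lambda>.\<close>

lemma sum_Path_Ghost:
  assumes "u \<in> Ob \<Lambda>" "v \<in> Ob \<Delta>"
  shows "(\<Sum>l\<in>with_rng_deg \<Lambda> u n. lin_ext (act (Path l)) (act (Ghost l) v)) =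
    act (Path (idt \<Lambda> u)) v"
proof -
  obtain f where f: "f \<in> Mor \<Delta>" "rng \<Delta> f = v" "deg \<Delta> f = n"
    using assms rng_deg_ex by metis
  have Ghost: "act (Ghost l) v = 0" if "l \<noteq> am f" "deg \<Lambda> l = n" for l
    using that f rng_deg_unique[of _ f] deg_am by (intro act_Ghost_zero) metis
  show ?thesis
  proof (cases "av v = u")
    case True
    have "(\<Sum>l\<in>with_rng_deg \<Lambda> u n. lin_ext (act (Path l)) (act (Ghost l) v)) =
       (\<Sum>l\<in>{am f}. lin_ext (act (Path l)) (act (Ghost l) v))"
      by (rule sum.mono_neutral_right)
       (use L.row_finite[OF assms(1)] True f Ghost in
         \<open>auto simp: with_rng_deg_def with_rng_def am_in rng_am deg_am\<close>)
    then show ?thesis using True f Path_Ghost[OF f(1) assms(2)] act_idt(1)[OF assms]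
      by auto
  next
    case False
    have "(\<Sum>l\<in>with_rng_deg \<Lambda> u n. lin_ext (act (Path l)) (act (Ghost l) v)) = 0"
      by (rule sum.neutral)
        (use False act_Ghost_rng_zero in \<open>auto simp: with_rng_deg_def with_rng_def\<close>)
    then show ?thesis using False act_idt(1)[OF assms] by auto
  qed
qed

lemma lin_ext_star:
  assumes "l \<in> Mor \<Lambda>" "x \<in> carr"
  shows "lin_ext (act (star \<Lambda> l)) x = lin_ext (act (Ghost l)) x"
  using assms by (intro lin_ext_cong act_star) (auto simp: carr_def)

lemma annihilates_KP:
  assumes "p \<in> KP1 \<Lambda> \<union> KP2 \<Lambda> \<union> KP3 \<Lambda> \<union> KP4 \<Lambda>"
  shows "annihilates p"
proof (rule annihilatesI)
  fix v assume v: "v \<in> Ob \<Delta>"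
  let ?A = "\<lambda>q. free_act (\<Delta>, \<alpha>) q (Poly_Mapping.single v 1)"
  note simps = free_act_diff free_act_sum free_act_mult free_act_gen act_star v lin_ext_star act_in_carr
  from assms consider "p \<in> KP1 \<Lambda>" | "p \<in> KP2 \<Lambda>" | "p \<in> KP3 \<Lambda>" | "p \<in> KP4 \<Lambda>" by blast
  then show "?A p = 0"
  proof cases
    case 1
    then show ?thesis
      by (auto simp: KP1_def simps Path_mult)
  next
    case 2
    then show ?thesis
      by (auto simp: KP2_def simps Ghost_mult L.cmp_in)
  next
    case 3
    then show ?thesis
      by (auto simp: KP3_def simps Ghost_Path)
  next
    case 4
    then obtain u n where u: "u \<in> Ob \<Lambda>" and p: "p = (\<Sum>l\<in>with_rng_deg \<Lambda> u n.
        gen (Path l) * gen (star \<Lambda> l)) - gen (Path (idt \<Lambda> u))"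
      by (auto simp: KP4_def)
    have "?A p = (\<Sum>l\<in>with_rng_deg \<Lambda> u n. lin_ext (act (Path l)) (act (star \<Lambda> l) v))
        - act (Path (idt \<Lambda> u)) v"
      by (simp add: p simps del: basis_act.simps act_star)
    also have "(\<Sum>l\<in>with_rng_deg \<Lambda> u n. lin_ext (act (Path l)) (act (star \<Lambda> l) v)) =
        (\<Sum>l\<in>with_rng_deg \<Lambda> u n. lin_ext (act (Path l)) (act (Ghost l) v))"
      by (rule sum.cong) (auto simp: act_star v with_rng_deg_def with_rng_def)
    finally show ?thesis using sum_Path_Ghost[OF u v] by simp
  qed
qed

text \<open>The elements acting as zero on the carrier form a two-sided ideal. Closure under
  multiplication from the right rests on the invariance of the carrier under the free
  algebra.\<close>

lemma annihilates_ideal: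
  assumes "p \<in> ideal_gen (free_alg (kp_gens \<Lambda>)) (KP1 \<Lambda> \<union> KP2 \<Lambda> \<union> KP3 \<Lambda> \<union> KP4 \<Lambda>)"
  shows "annihilates p"
  using assms
proof induction
  case (ideal_incl p)
  then show ?case by (rule annihilates_KP)
qed (simp_all add: annihilates_def free_act_add free_act_scale free_act_mult free_act_in_carr
    module_hom.zero[OF module_hom_free_act])

end

section \<open>The module structure\<close>

lemma free_alg_add: "\<lbrakk>p \<in> free_alg S; q \<in> free_alg S\<rbrakk> \<Longrightarrow> p + q \<in> free_alg S"
  using keys_add[of p q] by (force simp: free_alg_def)

lemma free_alg_scale: "p \<in> free_alg S \<Longrightarrow> pm_scale c p \<in> free_alg S"
  by (simp add: free_alg_def in_keys_iff)

lemma free_alg_mult: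
  assumes "p \<in> free_alg S" "q \<in> free_alg S"
  shows "p * q \<in> free_alg S"
  unfolding free_alg_def
proof (intro CollectI ballI)
  fix w assume "w \<in> Poly_Mapping.keys (p * q)"
  then obtain u v where "w = u + v" "u \<in> Poly_Mapping.keys p" "v \<in> Poly_Mapping.keys q"
    using keys_mult[of p q] by blast
  with assms show "letters w \<noteq> [] \<and> set (letters w) \<subseteq> S"
    by (force simp: free_alg_def plus_word_def)
qed

lemma gen_in_free_alg: "g \<in> S \<Longrightarrow> gen g \<in> free_alg S"
  by (simp add: free_alg_def gen_def)

lemma ideal_cong_refl: "p \<in> free_alg S \<Longrightarrow> (p, p) \<in> ideal_cong S R"
  by (simp add: ideal_cong_def ideal_zero)

section \<open>Action of congruence classes and their submodules\<close>

context representation_kgraph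
begin

abbreviation KPA :: "('K, ('K, 'n) kp_free set) nu_algebra" where "KPA \<equiv> KP \<Lambda>"
abbreviation V :: "('K, ('K, 'n) kp_free set, 'o \<Rightarrow>\<^sub>0 'K) alg_module" where
  "V \<equiv> rep_module (\<Delta>, \<alpha>)"
abbreviation kp_cong :: "(('K, 'n) kp_free \<times> ('K, 'n) kp_free) set" where
  "kp_cong \<equiv> ideal_cong (kp_gens \<Lambda>) (KP1 \<Lambda> \<union> KP2 \<Lambda> \<union> KP3 \<Lambda> \<union> KP4 \<Lambda>)"

lemma mcarrier_V [simp]: "mcarrier V = carr"
  by (simp add: rep_module_def carr_def)

lemma mscale_V [simp]: "mscale V = pm_scale"
  by (simp add: rep_module_def)

lemma kp_cong_free_act:
  assumes "(p, q) \<in> kp_cong" "x \<in> carr"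
  shows "free_act (\<Delta>, \<alpha>) q x = free_act (\<Delta>, \<alpha>) p x"
  using annihilates_ideal[of "p - q"] assms
  by (auto simp: ideal_cong_def annihilates_def free_act_diff)

lemma mact_eqI:
  assumes "p \<in> A" "\<And>q. q \<in> A \<Longrightarrow> free_act (\<Delta>, \<alpha>) q x = y"
  shows "mact V A x = y"
proof -
  have "(\<lambda>q. free_act (\<Delta>, \<alpha>) q x) ` A = {y}" using assms by force
  then show ?thesis by (simp add: rep_module_def)
qed

lemma mact_class:
  assumes "p \<in> free_alg (kp_gens \<Lambda>)" "x \<in> carr"
  shows "mact V (kp_cong `` {p}) x = free_act (\<Delta>, \<alpha>) p x"
  by (rule mact_eqI[of p])
    (use assms ideal_cong_refl[OF assms(1)] kp_cong_free_act in auto)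

lemma acarrier_KPA: "acarrier KPA = free_alg (kp_gens \<Lambda>) // kp_cong"
  and aadd_KPA: "aadd KPA A B = (\<Union>p\<in>A. \<Union>q\<in>B. kp_cong `` {p + q})"
  and amult_KPA: "amult KPA A B = (\<Union>p\<in>A. \<Union>q\<in>B. kp_cong `` {p * q})"
  and ascale_KPA: "ascale KPA c A = (\<Union>p\<in>A. kp_cong `` {pm_scale c p})"
  by (simp_all add: KP_def presented_algebra_def)

text \<open>Every representative of a class computes its action, so each module axiom reduces to the
  corresponding identity for the free algebra.\<close>

lemma acarrierE:
  assumes "A \<in> acarrier KPA"
  obtains p where "p \<in> A" "A \<subseteq> free_alg (kp_gens \<Lambda>)"
    "\<forall>q\<in>A. \<forall>x\<in>carr. free_act (\<Delta>, \<alpha>) q x = mact V A x"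
proof -
  obtain p where p: "p \<in> free_alg (kp_gens \<Lambda>)" "A = kp_cong `` {p}"
    using assms by (auto simp: acarrier_KPA elim: quotientE)
  show thesis
    by (rule that[of p])
      (use p in \<open>auto simp: mact_class ideal_cong_refl kp_cong_free_act\<close>, simp add: ideal_cong_def)
qed

lemma left_module_V: "left_module KPA V"
proof -
  have in_carr: "mact V A x \<in> carr" if A: "A \<in> acarrier KPA" and x: "x \<in> carr" for A x
  proof -
    obtain p where "p \<in> A" "\<forall>q\<in>A. \<forall>x\<in>carr. free_act (\<Delta>, \<alpha>) q x = mact V A x"
      by (rule acarrierE[OF A])
    then have "\<forall>x\<in>carr. mact V A x = free_act (\<Delta>, \<alpha>) p x" by simp
    then show ?thesis using x by (simp add: free_act_in_carr)
  qed
  have add_right: "mact V A (x + y) = mact V A x + mact V A y"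
    if A: "A \<in> acarrier KPA" and x: "x \<in> carr" "y \<in> carr" for A x y
  proof -
    obtain p where "p \<in> A" "\<forall>q\<in>A. \<forall>x\<in>carr. free_act (\<Delta>, \<alpha>) q x = mact V A x"
      by (rule acarrierE[OF A])
    then have "\<forall>x\<in>carr. mact V A x = free_act (\<Delta>, \<alpha>) p x" by simp
    then show ?thesis
      using x pm.subspace_add[OF subspace_carr x] by (simp add: free_act_add_right)
  qed
  have scale_right: "mact V A (pm_scale c x) = pm_scale c (mact V A x)"
    if A: "A \<in> acarrier KPA" and x: "x \<in> carr" for A c x
  proof -
    obtain p where "p \<in> A" "\<forall>q\<in>A. \<forall>x\<in>carr. free_act (\<Delta>, \<alpha>) q x = mact V A x"
      by (rule acarrierE[OF A])
    then have "\<forall>x\<in>carr. mact V A x = free_act (\<Delta>, \<alpha>) p x" by simp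
    then show ?thesis
      using x pm.subspace_scale[OF subspace_carr x, of c] by (simp add: free_act_scale_right)
  qed
  have add: "mact V (aadd KPA A B) x = mact V A x + mact V B x"
    if AB: "A \<in> acarrier KPA" "B \<in> acarrier KPA" and x: "x \<in> carr" for A B x
  proof -
    obtain p where p: "p \<in> A" "A \<subseteq> free_alg (kp_gens \<Lambda>)"
        "\<forall>q\<in>A. \<forall>x\<in>carr. free_act (\<Delta>, \<alpha>) q x = mact V A x"
      by (rule acarrierE[OF AB(1)])
    obtain q where q: "q \<in> B" "B \<subseteq> free_alg (kp_gens \<Lambda>)"
        "\<forall>r\<in>B. \<forall>x\<in>carr. free_act (\<Delta>, \<alpha>) r x = mact V B x"
      by (rule acarrierE[OF AB(2)])
    \<comment> \<open>The sum in the quotient is a union of relation images. Reflexivity puts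
      \<open>p + q\<close> into it, and all its other elements act in the same way, which is what
      \<open>mact_eqI\<close> asks for.\<close>
    have "(p + q, p + q) \<in> kp_cong" using p q by (intro ideal_cong_refl free_alg_add) auto
    then have "p + q \<in> aadd KPA A B"
      using p(1) q(1) unfolding aadd_KPA by blast
    moreover have "free_act (\<Delta>, \<alpha>) r x = mact V A x + mact V B x" if r: "r \<in> aadd KPA A B" for r
    proof -
      obtain p' q' where "p' \<in> A" "q' \<in> B" "(p' + q', r) \<in> kp_cong"
        using r unfolding aadd_KPA by blast
      then show ?thesis using p q x kp_cong_free_act[of "p' + q'" r x] by (simp add: free_act_add)
    qed
    ultimately show ?thesis by (rule mact_eqI)
  qed
  have mult: "mact V (amult KPA A B) x = mact V A (mact V B x)"
    if AB: "A \<in> acarrier KPA" "B \<in> acarrier KPA" and x: "x \<in> carr" for A B x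
  proof -
    obtain p where p: "p \<in> A" "A \<subseteq> free_alg (kp_gens \<Lambda>)"
        "\<forall>q\<in>A. \<forall>x\<in>carr. free_act (\<Delta>, \<alpha>) q x = mact V A x"
      by (rule acarrierE[OF AB(1)])
    obtain q where q: "q \<in> B" "B \<subseteq> free_alg (kp_gens \<Lambda>)"
        "\<forall>r\<in>B. \<forall>x\<in>carr. free_act (\<Delta>, \<alpha>) r x = mact V B x"
      by (rule acarrierE[OF AB(2)])
    have "(p * q, p * q) \<in> kp_cong" using p q by (intro ideal_cong_refl free_alg_mult) auto
    then have "p * q \<in> amult KPA A B"
      using p(1) q(1) unfolding amult_KPA by blast
    moreover have "free_act (\<Delta>, \<alpha>) r x = mact V A (mact V B x)" if r: "r \<in> amult KPA A B" for r
    proof -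
      obtain p' q' where "p' \<in> A" "q' \<in> B" "(p' * q', r) \<in> kp_cong"
        using r unfolding amult_KPA by blast
      then show ?thesis using p q x kp_cong_free_act[of "p' * q'" r x]
        in_carr[OF AB(2) x]
        by (simp add: free_act_mult)
    qed
    ultimately show ?thesis by (rule mact_eqI)
  qed
  have scale: "mact V (ascale KPA c A) x = pm_scale c (mact V A x)"
    if A: "A \<in> acarrier KPA" and x: "x \<in> carr" for c A x
  proof -
    obtain p where p: "p \<in> A" "A \<subseteq> free_alg (kp_gens \<Lambda>)"
        "\<forall>q\<in>A. \<forall>x\<in>carr. free_act (\<Delta>, \<alpha>) q x = mact V A x"
      by (rule acarrierE[OF A])
    have "(pm_scale c p, pm_scale c p) \<in> kp_cong"
      using p by (intro ideal_cong_refl free_alg_scale) auto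
    then have "pm_scale c p \<in> ascale KPA c A"
      using p(1) unfolding ascale_KPA by blast
    moreover have "free_act (\<Delta>, \<alpha>) r x = pm_scale c (mact V A x)" if r: "r \<in> ascale KPA c A" for r
    proof -
      obtain p' where "p' \<in> A" "(pm_scale c p', r) \<in> kp_cong"
        using r unfolding ascale_KPA by blast
      then show ?thesis using p x kp_cong_free_act[of "pm_scale c p'" r x]
        by (simp add: free_act_scale)
    qed
    ultimately show ?thesis by (rule mact_eqI)
  qed
  show ?thesis
    unfolding left_module_def mcarrier_V mscale_V
    by (intro conjI ballI allI vector_space_pm_scale subspace_carr in_carr add_right scale_right
        add scale mult)
qed

text \<open>The class of a generator acts as the corresponding letter. Ghosts of degree 0 are not
  generators, but on the carrier \<open>Ghost l\<close> agrees with
  \<open>star \<Lambda> l\<close>.\<close>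

lemma submodule_act_closed:
  assumes U: "submodule KPA V U" and l: "l \<in> Mor \<Lambda>" and x: "x \<in> U"
  shows "lin_ext (act (Path l)) x \<in> U" "lin_ext (act (Ghost l)) x \<in> U"
proof -
  have x': "x \<in> carr" using U x by (auto simp: submodule_def)
  have "lin_ext (act g) x \<in> U" if "g \<in> kp_gens \<Lambda>" for g
  proof -
    have "(gen g :: ('K, 'n) kp_free) \<in> free_alg (kp_gens \<Lambda>)" using that by (rule gen_in_free_alg)
    then have "kp_cong `` {gen g} \<in> acarrier KPA" "mact V (kp_cong `` {gen g}) x = lin_ext (act g) x"
      using x' by (simp_all add: acarrier_KPA quotientI mact_class free_act_gen)
    then show ?thesis using U x unfolding submodule_def by metis
  qed
  from this[of "Path l"] this[of "star \<Lambda> l"]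
  show "lin_ext (act (Path l)) x \<in> U" "lin_ext (act (Ghost l)) x \<in> U"
    using l x' lin_ext_star[of l x] by (auto simp: kp_gens_def)
qed

lemma lin_ext_Path_Ghost:
  assumes "f \<in> Mor \<Delta>" "x \<in> carr"
  shows "lin_ext (act (Path (am f))) (lin_ext (act (Ghost (am f))) x) =
    lin_ext (\<lambda>v. if \<exists>g\<in>Mor \<Delta>. rng \<Delta> g = v \<and> am g = am f then Poly_Mapping.single v 1 else 0) x"
    (is "?F x = lin_ext ?i x")
proof (rule module_hom_eq_on_keys[where F = ?F and G = "lin_ext ?i"])
  show "module_hom pm_scale pm_scale ?F"
    by unfold_locales (simp_all add: lin_ext_add lin_ext_scale)
  show "?F (Poly_Mapping.single v 1) = lin_ext ?i (Poly_Mapping.single v 1)"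
    if "v \<in> Poly_Mapping.keys x" for v
  proof -
    have "v \<in> Ob \<Delta>" using that assms by (auto simp: carr_def)
    then show ?thesis using assms by (simp add: Path_Ghost)
  qed
qed (rule module_hom_lin_ext)

text \<open>Having a common source is an equivalence relation on the vertices and contains every
  edge, so connectedness makes it total.\<close>

lemma common_source:
  assumes "u \<in> Ob \<Delta>" "v \<in> Ob \<Delta>"
  obtains f g where "f \<in> Mor \<Delta>" "g \<in> Mor \<Delta>" "rng \<Delta> f = u" "rng \<Delta> g = v" "src \<Delta> f = src \<Delta> g"
proof -
  let ?E = "{(u, v). u \<in> Ob \<Delta> \<and> v \<in> Ob \<Delta> \<and>
    (\<exists>f\<in>Mor \<Delta>. \<exists>g\<in>Mor \<Delta>. rng \<Delta> f = u \<and> rng \<Delta> g = v \<and> src \<Delta> f = src \<Delta> g)}"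
  have tr: "trans ?E"
  proof (rule transI)
    fix u v w assume uv: "(u, v) \<in> ?E" and vw: "(v, w) \<in> ?E"
    from uv obtain f g where fg: "f \<in> Mor \<Delta>" "g \<in> Mor \<Delta>" "rng \<Delta> f = u" "rng \<Delta> g = v"
      "src \<Delta> f = src \<Delta> g" by blast
    from vw obtain f' g' where fg': "f' \<in> Mor \<Delta>" "g' \<in> Mor \<Delta>" "rng \<Delta> f' = v" "rng \<Delta> g' = w"
      "src \<Delta> f' = src \<Delta> g'" by blast
    \<comment> \<open>Both \<open>g\<close> and \<open>f'\<close> end in \<open>v\<close>.
      Prolonging each at its source by the degree of the other gives two paths into \<open>v\<close>
      of the same degree, which must coincide.\<close>
    obtain k where k: "k \<in> Mor \<Delta>" "rng \<Delta> k = src \<Delta> g" "deg \<Delta> k = deg \<Delta> f'"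
      using rng_deg_ex[OF D.src_in[OF fg(2)]] by metis
    obtain k' where k': "k' \<in> Mor \<Delta>" "rng \<Delta> k' = src \<Delta> f'" "deg \<Delta> k' = deg \<Delta> g"
      using rng_deg_ex[OF D.src_in[OF fg'(1)]] by metis
    have "cmp \<Delta> g k = cmp \<Delta> f' k'"
      by (rule rng_deg_unique)
        (use fg fg' k k' in \<open>auto simp: D.cmp_in D.rng_cmp D.deg_cmp add.commute\<close>)
    then have "src \<Delta> k = src \<Delta> k'"
      using fg fg' k k' D.src_cmp[of g k] D.src_cmp[of f' k'] by simp
    then have "src \<Delta> (cmp \<Delta> f k) = src \<Delta> (cmp \<Delta> g' k')"
      using fg fg' k k' by (simp add: D.src_cmp)
    moreover have "cmp \<Delta> f k \<in> Mor \<Delta>" "cmp \<Delta> g' k' \<in> Mor \<Delta>"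
      "rng \<Delta> (cmp \<Delta> f k) = u" "rng \<Delta> (cmp \<Delta> g' k') = w"
      using fg fg' k k' by (simp_all add: D.cmp_in D.rng_cmp)
    ultimately show "(u, w) \<in> ?E" using uv vw by blast
  qed
  have "equiv (Ob \<Delta>) ?E"
  proof (rule equivI)
    show "refl_on (Ob \<Delta>) ?E"
      using D.idt_in D.rng_idt unfolding refl_on_def by blast
    show "sym ?E" unfolding sym_def by clarsimp metis
    show "trans ?E" by (rule tr)
  qed auto
  moreover have "(rng \<Delta> f, src \<Delta> f) \<in> ?E" if "f \<in> Mor \<Delta>" for f
  proof -
    have "idt \<Delta> (src \<Delta> f) \<in> Mor \<Delta>" "rng \<Delta> (idt \<Delta> (src \<Delta> f)) = src \<Delta> f"
      "src \<Delta> (idt \<Delta> (src \<Delta> f)) = src \<Delta> f"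
      using that by (simp_all add: D.src_in D.idt_in D.rng_idt D.src_idt)
    then show ?thesis using that D.rng_in D.src_in by fastforce
  qed
  ultimately have "(u, v) \<in> ?E" using assms by (rule D.generated_equiv_ObD)
  then show thesis using that by blast
qed

text \<open>The vertices that can occur in the image of \<open>v\<close> under an endomorphism. The
  condition is symmetric in the two vertices, because each receives exactly one path of each
  degree.\<close>

definition lifts_paths_of :: "'o \<Rightarrow> 'o set" where
  "lifts_paths_of v = {u \<in> Ob \<Delta>. \<forall>f\<in>Mor \<Delta>. rng \<Delta> f = v \<longrightarrow>
     (\<exists>g\<in>Mor \<Delta>. rng \<Delta> g = u \<and> am g = am f)}"

lemma self_in_lifts_paths_of: "v \<in> Ob \<Delta> \<Longrightarrow> v \<in> lifts_paths_of v"
  by (auto simp: lifts_paths_of_def)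

end

section \<open>Idempotent endomorphisms in the presence of a height\<close>

text \<open>Such a height excludes closed paths of nonzero degree, so not every representation graph
  carries one. The universal covering inherits one from the integer covering.\<close>

locale graded_representation = representation_kgraph \<Lambda> \<Delta> \<alpha> scalars
  for \<Lambda> :: "('p, 'n, 1) kgraph" and \<Delta> :: "('o, 'm, 1) kgraph" and \<alpha> and scalars :: "'K::field itself" +
  fixes h :: "'o \<Rightarrow> int"
  assumes height: "f \<in> Mor \<Delta> \<Longrightarrow> h (rng \<Delta> f) = h (src \<Delta> f) + int (deg \<Delta> f $ 1)"
begin

text \<open>Take paths into both vertices from a common source. Equal heights give equal degrees,
  hence equal images in \<Lambda>, and paths with the same source and the same image
  coincide.\<close>

lemma inj_on_height:
  assumes "v \<in> Ob \<Delta>"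
  shows "inj_on h (lifts_paths_of v)"
proof (rule inj_onI)
  fix u u' assume u: "u \<in> lifts_paths_of v" "u' \<in> lifts_paths_of v" "h u = h u'"
  then have "u \<in> Ob \<Delta>" "u' \<in> Ob \<Delta>" by (auto simp: lifts_paths_of_def)
  then obtain f g where fg: "f \<in> Mor \<Delta>" "g \<in> Mor \<Delta>" "rng \<Delta> f = u" "rng \<Delta> g = u'" "src \<Delta> f = src \<Delta> g"
    by (rule common_source)
  \<comment> \<open>Here it matters that the graphs are 1-graphs: the height difference along a path
    determines its whole degree.\<close>
  then have deg: "deg \<Delta> f = deg \<Delta> g"
    using u(3) height[of f] height[of g] by (simp add: vec_eq_iff forall_1)
  \<comment> \<open>The path \<open>e\<close> into \<open>v\<close> is the reference: every path of
    its degree into a vertex of \<open>lifts_paths_of v\<close> has the image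
    \<open>am e\<close>.\<close>
  obtain e where e: "e \<in> Mor \<Delta>" "rng \<Delta> e = v" "deg \<Delta> e = deg \<Delta> f"
    using rng_deg_ex[OF assms] by metis
  have lift: "am f' = am e" if f': "f' \<in> Mor \<Delta>" "rng \<Delta> f' \<in> lifts_paths_of v" "deg \<Delta> f' = deg \<Delta> f" for f'
  proof -
    obtain g' where "g' \<in> Mor \<Delta>" "rng \<Delta> g' = rng \<Delta> f'" "am g' = am e"
      using f'(2) e unfolding lifts_paths_of_def by blast
    then show ?thesis using f' e rng_deg_unique[of g' f'] deg_am by metis
  qed
  have "am f = am g" using lift[of f] lift[of g] fg deg u by simp
  then show "u = u'" using fg am_src_inj by metis
qed

text \<open>With the convolution product, \<open>int \<Rightarrow>\<^sub>0 'K\<close> is the group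
  algebra of the integers, that is, the ring of Laurent polynomials in one variable.\<close>

definition laurent :: "('o \<Rightarrow>\<^sub>0 'K) \<Rightarrow> (int \<Rightarrow>\<^sub>0 'K)" where
  "laurent = lin_ext (\<lambda>v. Poly_Mapping.single (h v) 1)"

lemma laurent_single [simp]: "laurent (Poly_Mapping.single v 1) = Poly_Mapping.single (h v) 1"
  by (simp add: laurent_def)

text \<open>By \<open>inj_on_height\<close> distinct vertices of the support become distinct
  monomials, so no coefficients can cancel.\<close>

lemma laurent_eq_zero:
  assumes "v \<in> Ob \<Delta>" "Poly_Mapping.keys x \<subseteq> lifts_paths_of v" "laurent x = 0"
  shows "x = 0"
proof (rule poly_mapping_eqI)
  fix u
  have "Poly_Mapping.lookup x u = 0" if u: "u \<in> Poly_Mapping.keys x"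
  proof -
    have "0 = Poly_Mapping.lookup (laurent x) (h u)" using assms by simp
    also have "\<dots> = (\<Sum>b\<in>Poly_Mapping.keys x. Poly_Mapping.lookup x b * (1 when h b = h u))"
      by (simp add: laurent_def lookup_lin_ext lookup_single)
    also have "\<dots> = (\<Sum>b\<in>Poly_Mapping.keys x. if b = u then Poly_Mapping.lookup x b else 0)"
      using u assms(2) inj_on_height[OF assms(1)]
      by (intro sum.cong) (auto simp: when_def inj_on_def)
    also have "\<dots> = Poly_Mapping.lookup x u" using u by simp
    finally show ?thesis by simp
  qed
  then show "Poly_Mapping.lookup x u = Poly_Mapping.lookup 0 u"
    by (auto simp: in_keys_iff)
qed

text \<open>The path \<open>am f\<close> lifts to every vertex of the support, so its ghost kills no
  term. It lowers all heights by the same degree, which amounts to multiplication by one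
  monomial.\<close>

lemma laurent_Ghost:
  assumes "f \<in> Mor \<Delta>" "Poly_Mapping.keys x \<subseteq> lifts_paths_of (rng \<Delta> f)"
  shows "laurent (lin_ext (act (Ghost (am f))) x) =
    Poly_Mapping.single (- int (deg \<Delta> f $ 1)) 1 * laurent x" (is "?F x = ?G x")
proof (rule module_hom_eq_on_keys[where F = ?F and G = ?G])
  show "module_hom pm_scale pm_scale ?F"
    by unfold_locales (simp_all add: laurent_def lin_ext_add lin_ext_scale)
  show "module_hom pm_scale pm_scale ?G"
    by unfold_locales (simp_all add: laurent_def lin_ext_add lin_ext_scale distrib_left pm_scale_mult_right)
  fix u assume "u \<in> Poly_Mapping.keys x"
  then obtain g where g: "g \<in> Mor \<Delta>" "rng \<Delta> g = u" "am g = am f"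
    using assms by (auto simp: lifts_paths_of_def)
  then have "deg \<Delta> g = deg \<Delta> f" using assms deg_am by metis
  then show "?F (Poly_Mapping.single u 1) = ?G (Poly_Mapping.single u 1)"
    using g act_Ghost[of g "am f" u] height[of g] by (simp add: mult_single)
qed

text \<open>The endomorphism is \<open>lin_ext \<phi>\<close>. Paths together with ghosts bound its
  supports, ghosts alone make its Laurent multiplier constant, and idempotence leaves 0 and
  1.\<close>

lemma idempotent_endomorphism_trivial:
  fixes \<phi> :: "'o \<Rightarrow> ('o \<Rightarrow>\<^sub>0 'K)"
  assumes carr: "\<And>v. v \<in> Ob \<Delta> \<Longrightarrow> \<phi> v \<in> carr"
    and comm_Path: "\<And>l x. \<lbrakk>l \<in> Mor \<Lambda>; x \<in> carr\<rbrakk> \<Longrightarrow>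
      lin_ext \<phi> (lin_ext (act (Path l)) x) = lin_ext (act (Path l)) (lin_ext \<phi> x)"
    and comm_Ghost: "\<And>l x. \<lbrakk>l \<in> Mor \<Lambda>; x \<in> carr\<rbrakk> \<Longrightarrow>
      lin_ext \<phi> (lin_ext (act (Ghost l)) x) = lin_ext (act (Ghost l)) (lin_ext \<phi> x)"
    and idem: "\<And>v. v \<in> Ob \<Delta> \<Longrightarrow> lin_ext \<phi> (\<phi> v) = \<phi> v"
  shows "(\<forall>v\<in>Ob \<Delta>. \<phi> v = 0) \<or> (\<forall>v\<in>Ob \<Delta>. \<phi> v = Poly_Mapping.single v 1)"
proof -
  have keys: "Poly_Mapping.keys (\<phi> v) \<subseteq> lifts_paths_of v" if v: "v \<in> Ob \<Delta>" for v
  proof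
    fix u assume u: "u \<in> Poly_Mapping.keys (\<phi> v)"
    have "\<exists>g\<in>Mor \<Delta>. rng \<Delta> g = u \<and> am g = am f" if f: "f \<in> Mor \<Delta>" "rng \<Delta> f = v" for f
    proof -
      \<comment> \<open>The projection belonging to \<open>am f\<close> fixes \<open>v\<close> and
        commutes with the endomorphism, so it fixes \<open>\<phi> v\<close>. Hence only vertices
        into which \<open>am f\<close> lifts occur in \<open>\<phi> v\<close>.\<close>
      let ?i = "\<lambda>v. if \<exists>g\<in>Mor \<Delta>. rng \<Delta> g = v \<and> am g = am f then Poly_Mapping.single v 1 else 0"
      have "\<phi> v = lin_ext \<phi> (lin_ext (act (Path (am f))) (act (Ghost (am f)) v))"
        using Path_Ghost[OF f(1) v] f by auto
      also have "\<dots> = lin_ext (act (Path (am f))) (lin_ext \<phi> (act (Ghost (am f)) v))"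
        using f v by (intro comm_Path) (simp_all add: am_in act_in_carr)
      also have "lin_ext \<phi> (act (Ghost (am f)) v) = lin_ext (act (Ghost (am f))) (\<phi> v)"
        using comm_Ghost[of "am f" "Poly_Mapping.single v 1"] f v by (simp add: am_in single_in_carr)
      also have "lin_ext (act (Path (am f))) (lin_ext (act (Ghost (am f))) (\<phi> v)) = lin_ext ?i (\<phi> v)"
        using f v carr by (intro lin_ext_Path_Ghost)
      finally have "u \<in> Poly_Mapping.keys (lin_ext ?i (\<phi> v))" using u by simp
      moreover have "Poly_Mapping.keys (lin_ext ?i (\<phi> v)) \<subseteq> {u. \<exists>g\<in>Mor \<Delta>. rng \<Delta> g = u \<and> am g = am f}"
        by (rule keys_lin_ext_subset) auto
      ultimately show ?thesis by auto
    qed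
    moreover have "u \<in> Ob \<Delta>" using carr[OF v] u by (auto simp: carr_def)
    ultimately show "u \<in> lifts_paths_of v" by (auto simp: lifts_paths_of_def)
  qed

  \<comment> \<open>Dividing by the monomial of \<open>v\<close> removes the dependence on the
    height of \<open>v\<close>, so that the multipliers of different vertices become
    comparable.\<close>
  define c where "c v = Poly_Mapping.single (- h v) 1 * laurent (\<phi> v)" for v
  have laurent_c: "laurent (\<phi> v) = c v * Poly_Mapping.single (h v) 1" for v
  proof -
    have "c v * Poly_Mapping.single (h v) 1 =
        (Poly_Mapping.single (h v) 1 * Poly_Mapping.single (- h v) 1) * laurent (\<phi> v)"
      unfolding c_def by (simp only: mult_ac)
    then show ?thesis by (simp add: mult_single)
  qed
  have c_edge: "c (rng \<Delta> f) = c (src \<Delta> f)" if f: "f \<in> Mor \<Delta>" for f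
  proof -
    \<comment> \<open>The ghost of \<open>am f\<close> carries \<open>rng \<Delta> f\<close> to
      \<open>src \<Delta> f\<close>. On the Laurent side it multiplies by exactly the monomial that
      accounts for the change of height.\<close>
    have "act (Ghost (am f)) (rng \<Delta> f) = Poly_Mapping.single (src \<Delta> f) 1"
      using f by (intro act_Ghost) auto
    then have "\<phi> (src \<Delta> f) = lin_ext (act (Ghost (am f))) (\<phi> (rng \<Delta> f))"
      using comm_Ghost[of "am f" "Poly_Mapping.single (rng \<Delta> f) 1"] f
      by (simp add: am_in single_in_carr D.rng_in)
    then show ?thesis
      using laurent_Ghost[OF f keys[OF D.rng_in[OF f]]] height[OF f]
      by (simp add: c_def mult.assoc[symmetric] mult_single)
  qed
  have c_const: "c u = c v" if "u \<in> Ob \<Delta>" "v \<in> Ob \<Delta>" for u v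
  proof -
    let ?E = "{(u, v). u \<in> Ob \<Delta> \<and> v \<in> Ob \<Delta> \<and> c u = c v}"
    have "equiv (Ob \<Delta>) ?E"
      by (auto simp: equiv_def refl_on_def sym_def trans_def)
    then have "(u, v) \<in> ?E"
      by (rule D.generated_equiv_ObD[OF _ _ that]) (simp add: c_edge D.rng_in D.src_in)
    then show ?thesis by simp
  qed
  obtain v0 where v0: "v0 \<in> Ob \<Delta>" using D.nonempty by blast
  have laurent_lin_ext: "laurent (lin_ext \<phi> x) = c v0 * laurent x" if "x \<in> carr" for x
  proof (rule module_hom_eq_on_keys[where F = "\<lambda>x. laurent (lin_ext \<phi> x)" and G = "\<lambda>x. c v0 * laurent x"])
    show "module_hom pm_scale pm_scale (\<lambda>x. laurent (lin_ext \<phi> x))"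
      by unfold_locales (simp_all add: laurent_def lin_ext_add lin_ext_scale)
    show "module_hom pm_scale pm_scale (\<lambda>x. c v0 * laurent x)"
      by unfold_locales
        (simp_all add: laurent_def lin_ext_add lin_ext_scale distrib_left pm_scale_mult_right)
    fix v assume "v \<in> Poly_Mapping.keys x"
    then have "v \<in> Ob \<Delta>" using that by (auto simp: carr_def)
    then show "laurent (lin_ext \<phi> (Poly_Mapping.single v 1)) = c v0 * laurent (Poly_Mapping.single v 1)"
      using c_const[of v v0] v0 by (simp add: laurent_c)
  qed
  \<comment> \<open>Multiplication by \<open>c v0\<close> describes the endomorphism on Laurent
    polynomials. It is applied here to \<open>\<phi> v0\<close>, which idempotence makes a fixed
    vector.\<close>
  have "c v0 * (c v0 * Poly_Mapping.single (h v0) 1) = c v0 * Poly_Mapping.single (h v0) 1"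
    using laurent_lin_ext[OF carr[OF v0]] idem[OF v0] by (simp add: laurent_c)
  \<comment> \<open>Laurent polynomials over a field have no zero divisors, so a nonzero
    \<open>c v0\<close> cancels, and below so does the monomial.\<close>
  then have "c v0 = 0 \<or> c v0 * Poly_Mapping.single (h v0) 1 = 1 * Poly_Mapping.single (h v0) 1"
    by simp
  moreover have "(Poly_Mapping.single (h v0) 1 :: int \<Rightarrow>\<^sub>0 'K) \<noteq> 0"
    by (metis lookup_single_eq lookup_zero zero_neq_one)
  ultimately consider "c v0 = 0" | "c v0 = 1"
    by (metis mult_cancel_right)
  then show ?thesis
  proof cases
    case 1
    then have "\<phi> v = 0" if "v \<in> Ob \<Delta>" for v
      using that keys c_const[OF that v0] by (intro laurent_eq_zero[of v]) (simp_all add: laurent_c)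
    then show ?thesis by blast
  next
    case 2
    have "\<phi> v - Poly_Mapping.single v 1 = 0" if v: "v \<in> Ob \<Delta>" for v
    proof (rule laurent_eq_zero[OF v])
      show "Poly_Mapping.keys (\<phi> v - Poly_Mapping.single v 1) \<subseteq> lifts_paths_of v"
        using keys[OF v] self_in_lifts_paths_of[OF v]
        by (auto simp: in_keys_iff lookup_minus lookup_single when_def split: if_splits)
      have "laurent (\<phi> v - Poly_Mapping.single v 1) = laurent (\<phi> v) - laurent (Poly_Mapping.single v 1)"
        by (simp add: laurent_def lin_ext_diff)
      then show "laurent (\<phi> v - Poly_Mapping.single v 1) = 0"
        using 2 c_const[OF v v0] by (simp add: laurent_c)
    qed
    then show ?thesis by simp
  qed
qed

text \<open>For a decomposition into \<open>U\<close> and \<open>W\<close>, the projection onto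
  \<open>U\<close> along \<open>W\<close> is an idempotent endomorphism. If it is zero, then
  \<open>U\<close> vanishes; if it is the identity, then \<open>W\<close> does.\<close>

lemma indecomposable_V: "indecomposable_module KPA V"
  unfolding indecomposable_module_def
proof (intro conjI notI)
  show "left_module KPA V" by (rule left_module_V)
  obtain v where v: "v \<in> Ob \<Delta>" using D.nonempty by blast
  have "(Poly_Mapping.single v 1 :: 'o \<Rightarrow>\<^sub>0 'K) \<noteq> 0"
    by (metis lookup_single_eq lookup_zero zero_neq_one)
  then show False if "mcarrier V = {0}" using single_in_carr[OF v, of 1] that by simp
  assume "\<exists>U W. submodule KPA V U \<and> submodule KPA V W \<and> U \<noteq> {0} \<and> W \<noteq> {0} \<and>
          U \<inter> W = {0} \<and> {u + w | u w. u \<in> U \<and> w \<in> W} = mcarrier V"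
  then obtain U W where U: "submodule KPA V U" "U \<noteq> {0}" and W: "submodule KPA V W" "W \<noteq> {0}"
    and int: "U \<inter> W = {0}" and sum: "{u + w | u w. u \<in> U \<and> w \<in> W} = carr"
    by auto
  have sU: "pm.subspace U" "U \<subseteq> carr" and sW: "pm.subspace W" "W \<subseteq> carr"
    using U W by (auto simp: submodule_def)
  \<comment> \<open>The \<open>U\<close>-components of the basis vectors are chosen one by one;
    linear extension turns the choice into the projection.\<close>
  have "\<exists>y\<in>U. Poly_Mapping.single v 1 - y \<in> W" if v: "v \<in> Ob \<Delta>" for v
  proof -
    have "Poly_Mapping.single v 1 \<in> {u + w | u w. u \<in> U \<and> w \<in> W}"
      unfolding sum using v by (rule single_in_carr)
    then obtain u w where "u \<in> U" "w \<in> W" "Poly_Mapping.single v 1 = u + w" by blast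
    then show ?thesis by (intro bexI[of _ u]) simp_all
  qed
  then obtain \<phi> where \<phi>: "\<And>v. v \<in> Ob \<Delta> \<Longrightarrow> \<phi> v \<in> U \<and> Poly_Mapping.single v 1 - \<phi> v \<in> W"
    by metis
  have in_U: "lin_ext \<phi> x \<in> U" and in_W: "x - lin_ext \<phi> x \<in> W" if x: "x \<in> carr" for x
  proof -
    show "lin_ext \<phi> x \<in> U"
      unfolding lin_ext_def using x \<phi>
      by (intro pm.subspace_sum[OF sU(1)] pm.subspace_scale[OF sU(1)]) (auto simp: carr_def)
    have "x - lin_ext \<phi> x = (\<Sum>v\<in>Poly_Mapping.keys x. pm_scale (Poly_Mapping.lookup x v)
        (Poly_Mapping.single v 1 - \<phi> v))"
      using sum_singles[of x] by (simp only: pm.scale_right_diff_distrib sum_subtractf lin_ext_def)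
    also have "\<dots> \<in> W"
      using x \<phi> by (intro pm.subspace_sum[OF sW(1)] pm.subspace_scale[OF sW(1)]) (auto simp: carr_def)
    finally show "x - lin_ext \<phi> x \<in> W" .
  qed
  \<comment> \<open>Since \<open>U\<close> and \<open>W\<close> meet only in 0, two memberships
    characterize the projection of \<open>x\<close>. Commutation with the letters and the values on
    \<open>U\<close> and \<open>W\<close> all follow from this.\<close>
  have unique: "lin_ext \<phi> x = u" if "x \<in> carr" "u \<in> U" "x - u \<in> W" for x u
  proof -
    have "lin_ext \<phi> x - u \<in> U" using in_U that by (intro pm.subspace_diff[OF sU(1)])
    moreover have "(x - u) - (x - lin_ext \<phi> x) \<in> W"
      by (rule pm.subspace_diff[OF sW(1) that(3) in_W[OF that(1)]])
    ultimately have "lin_ext \<phi> x - u \<in> U \<inter> W" by simp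
    then show ?thesis using int by simp
  qed
  have comm: "lin_ext \<phi> (lin_ext (act g) x) = lin_ext (act g) (lin_ext \<phi> x)"
    if "l \<in> Mor \<Lambda>" "x \<in> carr" "g = Path l \<or> g = Ghost l" for l x g
  proof (rule unique)
    show "lin_ext (act g) x \<in> carr" using that by (intro lin_ext_act_in_carr)
    show "lin_ext (act g) (lin_ext \<phi> x) \<in> U"
      using submodule_act_closed[OF U(1) that(1) in_U[OF that(2)]] that(3) by auto
    have "lin_ext (act g) (x - lin_ext \<phi> x) \<in> W"
      using submodule_act_closed[OF W(1) that(1) in_W[OF that(2)]] that(3) by auto
    then show "lin_ext (act g) x - lin_ext (act g) (lin_ext \<phi> x) \<in> W" by (simp add: lin_ext_diff)
  qed
  have fix_U: "lin_ext \<phi> u = u" if "u \<in> U" for u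
    using that sU by (intro unique) (auto simp: pm.subspace_0[OF sW(1)])
  have fix_W: "lin_ext \<phi> w = 0" if "w \<in> W" for w
    using that sW by (intro unique) (auto simp: pm.subspace_0[OF sU(1)])
  have "(\<forall>v\<in>Ob \<Delta>. \<phi> v = 0) \<or> (\<forall>v\<in>Ob \<Delta>. \<phi> v = Poly_Mapping.single v 1)"
    by (rule idempotent_endomorphism_trivial) (use \<phi> sU fix_U comm in auto)
  then show False
  proof
    assume zero: "\<forall>v\<in>Ob \<Delta>. \<phi> v = 0"
    have "u = 0" if "u \<in> U" for u
    proof -
      have "lin_ext \<phi> u = lin_ext (\<lambda>v. 0) u"
        using zero that sU by (intro lin_ext_cong) (auto simp: carr_def)
      then show ?thesis using fix_U[OF that] by (simp add: lin_ext_def)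
    qed
    then show False using U(2) pm.subspace_0[OF sU(1)] by auto
  next
    assume id: "\<forall>v\<in>Ob \<Delta>. \<phi> v = Poly_Mapping.single v 1"
    have "w = 0" if "w \<in> W" for w
    proof -
      have "lin_ext \<phi> w = lin_ext (\<lambda>v. Poly_Mapping.single v 1) w"
        using id that sW by (intro lin_ext_cong) (auto simp: carr_def)
      then show ?thesis using fix_W[OF that] sum_singles[of w] by (simp add: lin_ext_def)
    qed
    then show False using W(2) pm.subspace_0[OF sW(1)] by auto
  qed
qed

end

section \<open>The integer covering\<close>

text \<open>The full relation on \<open>A\<close> is among the relations intersected, which keeps
  the intersection inside \<open>A \<times> A\<close>. The remaining properties pass to
  intersections.\<close>

lemma equiv_generated_equiv:
  assumes "R \<subseteq> A \<times> A"
  shows "equiv A (generated_equiv A R)"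
proof -
  have "equiv A (A \<times> A)" by (auto simp: equiv_def refl_on_def sym_def trans_def)
  then have sub: "generated_equiv A R \<subseteq> A \<times> A"
    using assms by (auto simp: generated_equiv_def)
  show ?thesis
  proof (rule equivI)
    show "refl_on A (generated_equiv A R)"
      by (auto simp: generated_equiv_def refl_on_def equiv_def)
    show "sym (generated_equiv A R)"
      by (auto simp: generated_equiv_def sym_def equiv_def)
    show "trans (generated_equiv A R)"
      unfolding generated_equiv_def equiv_def trans_def by blast
  qed (rule sub)
qed

lemma generated_equiv_incl: "R \<subseteq> generated_equiv A R"
  by (auto simp: generated_equiv_def)

lemma generated_equiv_least: "\<lbrakk>equiv A E; R \<subseteq> E\<rbrakk> \<Longrightarrow> generated_equiv A R \<subseteq> E"
  by (auto simp: generated_equiv_def)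

text \<open>A universal covering is only compared with coverings over its own types, so the integer
  covering has to be coded into them.\<close>

lemma ex_bij_Times_int:
  includes cardinal_syntax
  shows "\<exists>e :: 'a::infinite \<times> int \<Rightarrow> 'a. bij e"
proof -
  have inf: "infinite (UNIV :: 'a set)" by (rule infinite_UNIV)
  have "|UNIV :: int set| \<le>o |UNIV :: nat set|"
    by (rule card_of_ordLeqI[of to_nat]) auto
  also have "|UNIV :: nat set| \<le>o |UNIV :: 'a set|"
    using inf by (simp add: infinite_iff_card_of_nat)
  finally have "|(UNIV :: 'a set) \<times> (UNIV :: int set)| =o |UNIV :: 'a set|"
    using inf by (intro card_of_Times_infinite_simps) auto
  then show ?thesis by (simp flip: card_of_ordIso)
qed

definition times_int_code :: "'a::infinite \<times> int \<Rightarrow> 'a" where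
  "times_int_code = (SOME e. bij e)"

lemma bij_times_int_code: "bij times_int_code"
  unfolding times_int_code_def by (rule someI_ex[OF ex_bij_Times_int])

definition times_int_decode :: "'a::infinite \<Rightarrow> 'a \<times> int" where
  "times_int_decode = inv times_int_code"

lemma times_int_decode_code [simp]: "times_int_decode (times_int_code z) = z"
  by (simp add: times_int_decode_def bij_is_inj[OF bij_times_int_code])

lemma times_int_code_eq_iff [simp]: "times_int_code z = times_int_code z' \<longleftrightarrow> z = z'"
  by (metis times_int_decode_code)

text \<open>The graph is unrolled along the coordinate \<open>i\<close> of the degree. The skew
  product need not be connected, and the base vertex selects one of its components.\<close>

locale pointed_k_graph = k_graph G for G :: "('o::infinite, 'm::infinite, 'k::finite) kgraph" +
  fixes i :: 'k and base :: 'o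
  assumes base: "base \<in> Ob G"
begin

abbreviation weight :: "'m \<Rightarrow> int" where "weight f \<equiv> int (deg G f $ i)"

definition skew_edges :: "(('o \<times> int) \<times> ('o \<times> int)) set" where
  "skew_edges = {((rng G f, n + weight f), (src G f, n)) | f n. f \<in> Mor G}"

definition component :: "('o \<times> int) set" where
  "component = generated_equiv (Ob G \<times> UNIV) skew_edges `` {(base, 0)}"

text \<open>The integer attached to a path is the height of its source, so the range lies higher by
  the weight, and a composite keeps the integer of the factor traversed first, which is the second
  argument of \<open>cmp\<close>.\<close>

definition cover :: "('o, 'm, 'k) kgraph" where
  "cover = \<lparr>
     Ob = times_int_code ` component,
     Mor = {times_int_code (f, n) | f n. f \<in> Mor G \<and> (src G f, n) \<in> component},
     src = (\<lambda>e. case times_int_decode e of (f, n) \<Rightarrow> times_int_code (src G f, n)),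
     rng = (\<lambda>e. case times_int_decode e of (f, n) \<Rightarrow> times_int_code (rng G f, n + weight f)),
     idt = (\<lambda>v. case times_int_decode v of (x, n) \<Rightarrow> times_int_code (idt G x, n)),
     cmp = (\<lambda>e e'. case (times_int_decode e, times_int_decode e') of ((f, _), (g, n)) \<Rightarrow>
       times_int_code (cmp G f g, n)),
     deg = (\<lambda>e. deg G (fst (times_int_decode e)))\<rparr>"

definition cover_map :: "('o, 'm, 'o, 'm) kmor" where
  "cover_map = (restrict (fst \<circ> times_int_decode) (Ob cover),
     restrict (fst \<circ> times_int_decode) (Mor cover))"

definition cover_height :: "'o \<Rightarrow> int" where
  "cover_height v = snd (times_int_decode v)"

section \<open>The component of the skew product and its paths\<close>

lemma skew_edges_subset: "skew_edges \<subseteq> (Ob G \<times> UNIV) \<times> (Ob G \<times> UNIV)"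
  by (auto simp: skew_edges_def src_in rng_in)

lemma component_subset: "component \<subseteq> Ob G \<times> UNIV"
  using equiv_generated_equiv[OF skew_edges_subset] by (auto simp: component_def equiv_def)

lemma component_Ob: "(x, n) \<in> component \<Longrightarrow> x \<in> Ob G"
  using component_subset by auto

lemma base_in_component: "(base, 0) \<in> component"
  using equiv_generated_equiv[OF skew_edges_subset] base
  by (auto simp: component_def equiv_def refl_on_def)

lemma component_edge:
  assumes "f \<in> Mor G"
  shows "(rng G f, n + weight f) \<in> component \<longleftrightarrow> (src G f, n) \<in> component"
proof -
  let ?E = "generated_equiv (Ob G \<times> UNIV) skew_edges"
  have e: "equiv (Ob G \<times> UNIV) ?E" by (rule equiv_generated_equiv[OF skew_edges_subset])
  have "((rng G f, n + weight f), (src G f, n)) \<in> ?E"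
    using assms generated_equiv_incl[of skew_edges] by (auto simp: skew_edges_def)
  then show ?thesis
    using e unfolding component_def equiv_def sym_def trans_def by blast
qed

lemma component_edge': "f \<in> Mor G \<Longrightarrow> (src G f, n - weight f) \<in> component \<longleftrightarrow> (rng G f, n) \<in> component"
  using component_edge[of f "n - weight f"] by simp

lemma Ob_cover: "Ob cover = times_int_code ` component"
  and Mor_cover: "Mor cover = {times_int_code (f, n) | f n. f \<in> Mor G \<and> (src G f, n) \<in> component}"
  by (simp_all add: cover_def)

lemma cover_simps [simp]:
  "times_int_code z \<in> Ob cover \<longleftrightarrow> z \<in> component"
  "times_int_code (f, n) \<in> Mor cover \<longleftrightarrow> f \<in> Mor G \<and> (src G f, n) \<in> component"
  "src cover (times_int_code (f, n)) = times_int_code (src G f, n)"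
  "rng cover (times_int_code (f, n)) = times_int_code (rng G f, n + weight f)"
  "idt cover (times_int_code (x, n)) = times_int_code (idt G x, n)"
  "cmp cover (times_int_code (f, m)) (times_int_code (g, n)) = times_int_code (cmp G f g, n)"
  "deg cover (times_int_code (f, n)) = deg G f"
  "cover_height (times_int_code (x, n)) = n"
  by (auto simp: cover_def cover_height_def)

lemma Ob_coverE:
  assumes "v \<in> Ob cover"
  obtains x n where "v = times_int_code (x, n)" "(x, n) \<in> component" "x \<in> Ob G"
  using assms component_Ob by (auto simp: Ob_cover)

lemma Mor_coverE:
  assumes "e \<in> Mor cover"
  obtains f n where "e = times_int_code (f, n)" "f \<in> Mor G" "(src G f, n) \<in> component"
  using assms by (auto simp: Mor_cover)

lemma with_src_cover:
  assumes "(x, n) \<in> component"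
  shows "with_src cover (times_int_code (x, n)) = (\<lambda>f. times_int_code (f, n)) ` with_src G x"
  using assms by (auto simp: with_src_def elim!: Mor_coverE)

text \<open>The height is prescribed at the range, whereas the code of a path carries the height of
  its source; hence the shift by the weight.\<close>

lemma with_rng_cover:
  assumes "(x, n) \<in> component"
  shows "with_rng cover (times_int_code (x, n)) =
    (\<lambda>f. times_int_code (f, n - weight f)) ` with_rng G x"
  using assms by (auto simp: with_rng_def component_edge' elim!: Mor_coverE)

lemma with_rng_deg_cover:
  assumes "(x, n) \<in> component"
  shows "with_rng_deg cover (times_int_code (x, n)) d =
    (\<lambda>f. times_int_code (f, n - weight f)) ` with_rng_deg G x d"
  by (auto simp: with_rng_deg_def with_rng_cover[OF assms])

text \<open>The component is a class of a relation generated on all pairs, whereas connectedness of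
  \<open>cover\<close> concerns relations on its coded vertices. The proof transfers from the latter
  to the former.\<close>

lemma component_connected:
  assumes E: "equiv (Ob cover) E" and R: "{(rng cover e, src cover e) | e. e \<in> Mor cover} \<subseteq> E"
    and z: "z \<in> component"
  shows "(times_int_code (base, 0), times_int_code z) \<in> E"
proof -
  let ?A = "Ob G \<times> (UNIV :: int set)"
  \<comment> \<open>This extends \<open>E\<close> to all pairs: inside the component it is
    \<open>E\<close>, outside it everything is related, and the two regions are kept apart. It
    contains all skew edges because they never leave the component.\<close>
  let ?E = "{(a, b). a \<in> ?A \<and> b \<in> ?A \<and> (a \<in> component \<longleftrightarrow> b \<in> component) \<and>
    (a \<in> component \<longrightarrow> (times_int_code a, times_int_code b) \<in> E)}"
  have "equiv ?A ?E"
  proof (rule equivI)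
    show "refl_on ?A ?E" using E by (auto simp: refl_on_def equiv_def)
    show "sym ?E" using E unfolding sym_def equiv_def by blast
    show "trans ?E" using E unfolding trans_def equiv_def by blast
  qed auto
  moreover have "skew_edges \<subseteq> ?E"
  proof
    fix z assume "z \<in> skew_edges"
    then obtain f n where z: "z = ((rng G f, n + weight f), (src G f, n))" "f \<in> Mor G"
      by (auto simp: skew_edges_def)
    have "(times_int_code (rng G f, n + weight f), times_int_code (src G f, n)) \<in> E"
      if "(src G f, n) \<in> component"
    proof -
      have "times_int_code (f, n) \<in> Mor cover" using that z by simp
      then have "(rng cover (times_int_code (f, n)), src cover (times_int_code (f, n))) \<in> E"
        using R by blast
      then show ?thesis by simp
    qed
    then show "z \<in> ?E" using z by (simp add: component_edge rng_in src_in)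
  qed
  ultimately have "generated_equiv ?A skew_edges \<subseteq> ?E" by (rule generated_equiv_least)
  then show ?thesis using z base_in_component by (auto simp: component_def)
qed

section \<open>The component as a k-graph and as a covering\<close>

lemma small_category_cover: "small_category cover"
proof
  fix e assume "e \<in> Mor cover"
  then show "src cover e \<in> Ob cover" "rng cover e \<in> Ob cover"
    "cmp cover e (idt cover (src cover e)) = e" "cmp cover (idt cover (rng cover e)) e = e"
    by (auto elim!: Mor_coverE simp: component_edge cmp_idt idt_cmp)
next
  fix v assume "v \<in> Ob cover"
  then show "idt cover v \<in> Mor cover" "src cover (idt cover v) = v" "rng cover (idt cover v) = v"
    by (auto elim!: Ob_coverE simp: idt_in src_idt rng_idt deg_idt)
next
  fix e e' assume "e \<in> Mor cover" "e' \<in> Mor cover" "src cover e = rng cover e'"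
  then show "cmp cover e e' \<in> Mor cover" "src cover (cmp cover e e') = src cover e'"
    "rng cover (cmp cover e e') = rng cover e"
    by (auto elim!: Mor_coverE simp: cmp_in src_cmp rng_cmp deg_cmp)
next
  fix e e' e'' assume "e \<in> Mor cover" "e' \<in> Mor cover" "e'' \<in> Mor cover"
    "src cover e = rng cover e'" "src cover e' = rng cover e''"
  then show "cmp cover (cmp cover e e') e'' = cmp cover e (cmp cover e' e'')"
    by (auto elim!: Mor_coverE simp: cmp_assoc)
qed

lemma factorization_cover:
  assumes e: "e \<in> Mor cover" and deg: "deg cover e = a + b"
  shows "\<exists>!(g, h). g \<in> Mor cover \<and> h \<in> Mor cover \<and> src cover g = rng cover h \<and>
        deg cover g = a \<and> deg cover h = b \<and> e = cmp cover g h"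
proof -
  from e obtain f n where f: "e = times_int_code (f, n)" "f \<in> Mor G" "(src G f, n) \<in> component"
    by (rule Mor_coverE)
  have "deg G f = a + b" using deg f by simp
  from factorizationE[OF f(2) this] obtain g h where gh: "g \<in> Mor G" "h \<in> Mor G"
    "src G g = rng G h" "deg G g = a" "deg G h = b" "f = cmp G g h" by blast
  show ?thesis
  \<comment> \<open>The heights of the factors are forced: \<open>h\<close> starts at the source of
    the whole path, and \<open>g\<close> starts at the range of \<open>h\<close>.\<close>
  proof (rule ex1I[of _ "(times_int_code (g, n + weight h), times_int_code (h, n))"], goal_cases)
    case 1
    then show ?case using f gh by (auto simp: component_edge src_cmp)
  next
    case (2 p)
    then obtain e1 e2 where p: "p = (e1, e2)" "e1 \<in> Mor cover" "e2 \<in> Mor cover"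
      "src cover e1 = rng cover e2" "deg cover e1 = a" "deg cover e2 = b" "e = cmp cover e1 e2"
      by auto
    obtain g' k where g': "e1 = times_int_code (g', k)" "g' \<in> Mor G" using p(2) by (rule Mor_coverE)
    obtain h' l where h': "e2 = times_int_code (h', l)" "h' \<in> Mor G" using p(3) by (rule Mor_coverE)
    have eqs: "src G g' = rng G h'" "k = l + weight h'" "cmp G g h = cmp G g' h'" "l = n"
      "deg G g' = a" "deg G h' = b"
      using p g' h' f gh by auto
    have "g = g'" "h = h'"
      by (rule factorization_cancel[of g h g' h']; use gh g' h' eqs in simp)+
    then show ?case using p g' h' eqs by simp
  qed
qed

lemma k_graph_cover: "k_graph cover"
proof -
  interpret cov: small_category cover by (rule small_category_cover)
  show ?thesis
  proof
    show "deg cover (idt cover v) = 0" if "v \<in> Ob cover" for v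
      using that by (auto elim!: Ob_coverE simp: deg_idt)
    show "deg cover (cmp cover f g) = deg cover f + deg cover g"
      if "f \<in> Mor cover" "g \<in> Mor cover" "src cover f = rng cover g" for f g
      using that by (auto elim!: Mor_coverE simp: deg_cmp)
    show "\<exists>!(g, h). g \<in> Mor cover \<and> h \<in> Mor cover \<and> src cover g = rng cover h \<and>
        deg cover g = m \<and> deg cover h = n \<and> f = cmp cover g h"
      if "f \<in> Mor cover" "deg cover f = m + n" for f m n
      using that by (rule factorization_cover)
    show "Ob cover \<noteq> {}" using base_in_component by (auto simp: Ob_cover)
    have sub: "{(rng cover e, src cover e) | e. e \<in> Mor cover} \<subseteq> Ob cover \<times> Ob cover"
      by (auto simp: cov.src_in cov.rng_in)
    have eq: "equiv (Ob cover) (connected_rel cover)"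
      unfolding connected_rel_def by (rule equiv_generated_equiv[OF sub])
    have incl: "{(rng cover e, src cover e) | e. e \<in> Mor cover} \<subseteq> connected_rel cover"
      unfolding connected_rel_def by (rule generated_equiv_incl)
    \<comment> \<open>Every vertex is related to the base vertex; symmetry and transitivity then
      relate any two.\<close>
    have from_base: "(times_int_code (base, 0), v) \<in> connected_rel cover" if "v \<in> Ob cover" for v
      using that component_connected[OF eq incl] unfolding Ob_cover by blast
    have "(u, v) \<in> connected_rel cover" if "u \<in> Ob cover" "v \<in> Ob cover" for u v
      using from_base[OF that(1)] from_base[OF that(2)] eq unfolding equiv_def
      by (meson symD transD)
    moreover have "connected_rel cover \<subseteq> Ob cover \<times> Ob cover"
      using eq by (simp add: equiv_def)
    ultimately show "connected_rel cover = Ob cover \<times> Ob cover" by auto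
    show "finite (with_rng_deg cover v n)" if "v \<in> Ob cover" for v n
      using that by (elim Ob_coverE) (simp add: with_rng_deg_cover row_finite)
    show "with_rng_deg cover v n \<noteq> {}" if "v \<in> Ob cover" for v n
      using that by (elim Ob_coverE) (simp add: with_rng_deg_cover no_sources)
  qed
qed

text \<open>A path of \<open>G\<close> has exactly one lift once the height of either of its ends is
  prescribed. These lifts are the inverse maps in the two bijections.\<close>

lemma covering_cover: "covering G (cover, cover_map)"
proof -
  interpret cov: small_category cover by (rule small_category_cover)
  have ob [simp]: "fst cover_map (times_int_code (x, n)) = x" if "(x, n) \<in> component" for x n
    using that by (simp add: cover_map_def)
  have mor [simp]: "snd cover_map (times_int_code (f, n)) = f"
    if "f \<in> Mor G" "(src G f, n) \<in> component" for f n
    using that by (simp add: cover_map_def)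
  have "kgraph_mor cover G cover_map"
    unfolding kgraph_mor_def
  proof (intro conjI ballI impI)
    show "fst cover_map \<in> Ob cover \<rightarrow>\<^sub>E Ob G" "snd cover_map \<in> Mor cover \<rightarrow>\<^sub>E Mor G"
      by (auto simp: cover_map_def elim!: Mor_coverE Ob_coverE)
    fix e assume e: "e \<in> Mor cover"
    show "src G (snd cover_map e) = fst cover_map (src cover e)"
      "rng G (snd cover_map e) = fst cover_map (rng cover e)"
      "deg G (snd cover_map e) = deg cover e"
      using e by (auto elim!: Mor_coverE simp: component_edge)
    fix e' assume "e' \<in> Mor cover" "src cover e = rng cover e'"
    then show "snd cover_map (cmp cover e e') = cmp G (snd cover_map e) (snd cover_map e')"
      using e by (auto elim!: Mor_coverE simp: cmp_in src_cmp)
  next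
    fix v assume "v \<in> Ob cover"
    then show "snd cover_map (idt cover v) = idt G (fst cover_map v)"
      by (auto elim!: Ob_coverE simp: idt_in src_idt)
  qed
  moreover have "bij_betw (snd cover_map) (with_src cover v) (with_src G (fst cover_map v))"
    "bij_betw (snd cover_map) (with_rng cover v) (with_rng G (fst cover_map v))"
    if "v \<in> Ob cover" for v
  proof -
    from that obtain x n where v: "v = times_int_code (x, n)" and xn: "(x, n) \<in> component"
      by (rule Ob_coverE)
    have "bij_betw (snd cover_map) ((\<lambda>f. times_int_code (f, n)) ` with_src G x) (with_src G x)"
      by (rule bij_betw_byWitness[where f' = "\<lambda>f. times_int_code (f, n)"])
        (use xn in \<open>auto simp: with_src_def\<close>)
    then show "bij_betw (snd cover_map) (with_src cover v) (with_src G (fst cover_map v))"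
      using xn by (simp add: v with_src_cover)
    have "bij_betw (snd cover_map) ((\<lambda>f. times_int_code (f, n - weight f)) ` with_rng G x) (with_rng G x)"
      by (rule bij_betw_byWitness[where f' = "\<lambda>f. times_int_code (f, n - weight f)"])
        (use xn in \<open>auto simp: with_rng_def component_edge'\<close>)
    then show "bij_betw (snd cover_map) (with_rng cover v) (with_rng G (fst cover_map v))"
      using xn by (simp add: v with_rng_cover)
  qed
  ultimately show ?thesis by (simp add: covering_def k_graph_cover)
qed

lemma cover_height: "e \<in> Mor cover \<Longrightarrow>
    cover_height (rng cover e) = cover_height (src cover e) + int (deg cover e $ i)"
  by (auto elim!: Mor_coverE)

end

text \<open>Universality supplies a morphism to the integer covering. It preserves sources, ranges
  and degrees, so the height pulls back along its vertex map.\<close>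

lemma universal_covering_height:
  fixes \<Delta> \<Omega> :: "('o::infinite, 'm::infinite, 'k::finite) kgraph"
  assumes "k_graph \<Delta>" "universal_covering \<Delta> (\<Omega>, \<tau>)"
  obtains h where "\<forall>f\<in>Mor \<Omega>. h (rng \<Omega> f) = h (src \<Omega> f) + int (deg \<Omega> f $ i)"
proof -
  interpret k_graph \<Delta> by fact
  obtain x0 where "x0 \<in> Ob \<Delta>" using nonempty by blast
  then interpret pointed_k_graph \<Delta> i x0 by unfold_locales
  obtain \<phi> where "covering_mor (\<Omega>, \<tau>) (cover, cover_map) \<phi>"
    using assms(2) covering_cover unfolding universal_covering_def by blast
  then have \<phi>: "kgraph_mor \<Omega> cover \<phi>" by (simp add: covering_mor_def)
  show thesis
  proof (rule that[of "cover_height \<circ> fst \<phi>"], rule ballI)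
    fix f assume "f \<in> Mor \<Omega>"
    then have "snd \<phi> f \<in> Mor cover" "rng cover (snd \<phi> f) = fst \<phi> (rng \<Omega> f)"
      "src cover (snd \<phi> f) = fst \<phi> (src \<Omega> f)" "deg cover (snd \<phi> f) = deg \<Omega> f"
      using \<phi> by (auto simp: kgraph_mor_def)
    then show "(cover_height \<circ> fst \<phi>) (rng \<Omega> f) = (cover_height \<circ> fst \<phi>) (src \<Omega> f) + int (deg \<Omega> f $ i)"
      using cover_height[of "snd \<phi> f"] by simp
  qed
qed

section \<open>Transfer to the universal covering of a representation graph\<close>

lemma kgraph_mor_comp:
  assumes "small_category G" "kgraph_mor G H \<phi>" "kgraph_mor H J \<psi>"
  shows "kgraph_mor G J (kmor_comp G \<psi> \<phi>)"
proof -
  interpret small_category G by fact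
  note in_H = assms(2)[unfolded kgraph_mor_def] and in_J = assms(3)[unfolded kgraph_mor_def]
  have \<phi>: "\<And>v. v \<in> Ob G \<Longrightarrow> fst \<phi> v \<in> Ob H" "\<And>f. f \<in> Mor G \<Longrightarrow> snd \<phi> f \<in> Mor H"
    and \<psi>: "\<And>v. v \<in> Ob H \<Longrightarrow> fst \<psi> v \<in> Ob J" "\<And>f. f \<in> Mor H \<Longrightarrow> snd \<psi> f \<in> Mor J"
    using in_H in_J by auto
  show ?thesis
    using in_H in_J \<phi> \<psi>
    by (auto simp: kgraph_mor_def kmor_comp_def compose_def src_in rng_in idt_in cmp_in)
qed

text \<open>On paths with a given source two bijections compose. For a given range and degree,
  \<tau> maps injectively into a singleton, and absence of sources provides a path.\<close>

lemma rep_kgraph_covering: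
  assumes "rep_kgraph \<Lambda> (\<Delta>, \<alpha>)" "covering \<Delta> (\<Omega>, \<tau>)"
  shows "rep_kgraph \<Lambda> (\<Omega>, kmor_comp \<Omega> \<alpha> \<tau>)"
proof -
  have \<Omega>: "k_graph \<Omega>" and \<tau>: "kgraph_mor \<Omega> \<Delta> \<tau>" and \<alpha>: "kgraph_mor \<Delta> \<Lambda> \<alpha>"
    using assms by (simp_all add: covering_def rep_kgraph_def)
  interpret k_graph \<Omega> by (rule \<Omega>)
  have \<tau>_ob: "fst \<tau> v \<in> Ob \<Delta>" if "v \<in> Ob \<Omega>" for v using \<tau> that by (auto simp: kgraph_mor_def)
  have \<tau>_deg: "deg \<Delta> (snd \<tau> f) = deg \<Omega> f" if "f \<in> Mor \<Omega>" for f
    using \<tau> that by (auto simp: kgraph_mor_def)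
  have "kgraph_mor \<Omega> \<Lambda> (kmor_comp \<Omega> \<alpha> \<tau>)"
    using small_category_axioms \<tau> \<alpha> by (rule kgraph_mor_comp)
  moreover have "bij_betw (snd (kmor_comp \<Omega> \<alpha> \<tau>)) (with_src \<Omega> v)
      (with_src \<Lambda> (fst (kmor_comp \<Omega> \<alpha> \<tau>) v))" if v: "v \<in> Ob \<Omega>" for v
  proof -
    have "bij_betw (snd \<alpha> \<circ> snd \<tau>) (with_src \<Omega> v) (with_src \<Lambda> (fst \<alpha> (fst \<tau> v)))"
      using assms v \<tau>_ob[OF v] by (intro bij_betw_trans) (auto simp: covering_def rep_kgraph_def)
    \<comment> \<open>The extensional composite agrees with the plain one on the paths with source
      \<open>v\<close>.\<close>
    then have "bij_betw (snd (kmor_comp \<Omega> \<alpha> \<tau>)) (with_src \<Omega> v) (with_src \<Lambda> (fst \<alpha> (fst \<tau> v)))"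
      by (rule bij_betw_cong[THEN iffD1, rotated])
        (simp add: kmor_comp_def compose_def with_src_def)
    then show ?thesis using v by (simp add: kmor_comp_def compose_def)
  qed
  moreover have "\<exists>\<delta>. with_rng_deg \<Omega> v n = {\<delta>}" if v: "v \<in> Ob \<Omega>" for v n
  proof -
    obtain \<delta> where \<delta>: "with_rng_deg \<Delta> (fst \<tau> v) n = {\<delta>}"
      using assms(1) \<tau>_ob[OF v] unfolding rep_kgraph_def by blast
    have bij: "bij_betw (snd \<tau>) (with_rng \<Omega> v) (with_rng \<Delta> (fst \<tau> v))"
      using assms v by (simp add: covering_def)
    have "snd \<tau> f = \<delta>" if "f \<in> with_rng_deg \<Omega> v n" for f
    proof -
      have "snd \<tau> f \<in> with_rng_deg \<Delta> (fst \<tau> v) n"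
        using that bij \<tau>_deg by (auto simp: with_rng_deg_def with_rng_def bij_betw_def)
      then show ?thesis by (simp add: \<delta>)
    qed
    moreover have "inj_on (snd \<tau>) (with_rng_deg \<Omega> v n)"
      using bij by (auto simp: bij_betw_def with_rng_deg_def intro: inj_on_subset)
    ultimately have "f = g" if "f \<in> with_rng_deg \<Omega> v n" "g \<in> with_rng_deg \<Omega> v n" for f g
      using that by (metis inj_onD)
    then show ?thesis using no_sources[OF v, of n] by blast
  qed
  ultimately show ?thesis by (simp add: rep_kgraph_def \<Omega>)
qed

lemma connected_component_RG_Ob:
  assumes "C \<in> connected_components (RG \<Lambda>)" "X \<in> Ob C"
  shows "rep_kgraph \<Lambda> X"
proof -
  have "{(rng (RG \<Lambda>) f, src (RG \<Lambda>) f) | f. f \<in> Mor (RG \<Lambda>)} \<subseteq> Ob (RG \<Lambda>) \<times> Ob (RG \<Lambda>)"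
    by (auto simp: RG_def)
  then have "equiv (Ob (RG \<Lambda>)) (connected_rel (RG \<Lambda>))"
    unfolding connected_rel_def by (rule equiv_generated_equiv)
  then have "X \<in> Ob (RG \<Lambda>)"
    using assms by (auto simp: connected_components_def full_subcategory_def quotient_def equiv_def)
  then show ?thesis by (simp add: RG_def)
qed

theorem corollary42:
  fixes \<Lambda> :: "('p, 'n, 1) kgraph"
    and C :: "(('o::infinite, 'm::infinite, 'p, 'n, 1) over,
      ('o, 'm, 'p, 'n, 1) over \<times> ('o, 'm, 'o, 'm) kmor \<times> ('o, 'm, 'p, 'n, 1) over) category"
    and \<Delta> \<Omega> :: "('o, 'm, 1) kgraph"
  assumes "k_graph \<Lambda>"
    and "C \<in> connected_components (RG \<Lambda>)"
    and "(\<Delta>, \<alpha>) \<in> Ob C"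
    and "universal_covering \<Delta> (\<Omega>, \<tau>)"
  shows "indecomposable_module (KP \<Lambda> :: ('K::field, ('K, 'n) kp_free set) nu_algebra)
    (rep_module (\<Omega>, kmor_comp \<Omega> \<alpha> \<tau>))"
proof -
  have \<Delta>: "rep_kgraph \<Lambda> (\<Delta>, \<alpha>)" using assms(2,3) by (rule connected_component_RG_Ob)
  then have "k_graph \<Delta>" by (simp add: rep_kgraph_def)
  then obtain h where h: "\<forall>f\<in>Mor \<Omega>. h (rng \<Omega> f) = h (src \<Omega> f) + int (deg \<Omega> f $ 1)"
    using assms(4) by (rule universal_covering_height)
  have "rep_kgraph \<Lambda> (\<Omega>, kmor_comp \<Omega> \<alpha> \<tau>)"
    using \<Delta> assms(4) by (intro rep_kgraph_covering) (auto simp: universal_covering_def)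
  with assms(1) interpret representation_kgraph \<Lambda> \<Omega> "kmor_comp \<Omega> \<alpha> \<tau>" "TYPE('K)"
    by (rule representation_kgraph.intro)
  interpret graded_representation \<Lambda> \<Omega> "kmor_comp \<Omega> \<alpha> \<tau>" "TYPE('K)" h
    by unfold_locales (use h in simp)
  show ?thesis by (rule indecomposable_V)
qed

end
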